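(* Let $n\geq 4$ and let $P$ be a convex $n$-gon. If $T_1$ and $T_2$ are triangulations of $P$ whose sets of internal triangles coincide (i.e. the internal triangles of $T_1$ are exactly the internal triangles of $T_2$, as triangles with vertices among those of $P$), then the number of triangulations of $P$ disjoint from $T_1$ equals the number of triangulations of $P$ disjoint from $T_2$. In other words, the number of triangulations disjoint from a triangulation $T$ depends only on the position of the internal triangles of $T$.
   Context: A triangulation of a convex polygon $P$ uses non-crossing diagonals to divide $P$ into triangles. An internal triangle of a triangulation is one of its triangles that shares no side with $P$. Two triangulations of $P$ are disjoint if they have no diagonals in common. *)

theory Defs
  imports Main
begin

text \<open>Combinatorial model of a convex n-gon P: vertices 0,...,n-1 in cyclic order.
  A segment between two vertices is the doubleton set of its endpoints.\<close>

definition is_side :: "nat \<Rightarrow> nat \<Rightarrow> nat \<Rightarrow> bool" where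
  "is_side n i j \<longleftrightarrow> i < n \<and> j < n \<and> (j = (i + 1) mod n \<or> i = (j + 1) mod n)"

definition diagonals :: "nat \<Rightarrow> nat set set" where
  "diagonals n = {{i, j} | i j. i < n \<and> j < n \<and> i \<noteq> j \<and> \<not> is_side n i j}"

text \<open>Two chords of a convex polygon cross (in their interiors) iff their endpoints interleave.\<close>
definition crosses :: "nat set \<Rightarrow> nat set \<Rightarrow> bool" where
  "crosses d1 d2 \<longleftrightarrow> (\<exists>a b c d. a < c \<and> c < b \<and> b < d \<and>
      ((d1 = {a, b} \<and> d2 = {c, d}) \<or> (d1 = {c, d} \<and> d2 = {a, b})))"

definition noncrossing :: "nat set set \<Rightarrow> bool" where
  "noncrossing S \<longleftrightarrow> (\<forall>d1\<in>S. \<forall>d2\<in>S. \<not> crosses d1 d2)"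

definition triangulation :: "nat \<Rightarrow> nat set set \<Rightarrow> bool" where
  "triangulation n T \<longleftrightarrow> T \<subseteq> diagonals n \<and> noncrossing T \<and>
     (\<forall>d \<in> diagonals n - T. \<not> noncrossing (insert d T))"

definition triangles :: "nat \<Rightarrow> nat set set \<Rightarrow> nat set set" where
  "triangles n T = {{a, b, c} | a b c. a < b \<and> b < c \<and> c < n \<and>
      (is_side n a b \<or> {a, b} \<in> T) \<and> (is_side n b c \<or> {b, c} \<in> T) \<and>
      (is_side n a c \<or> {a, c} \<in> T)}"

definition internal_triangles :: "nat \<Rightarrow> nat set set \<Rightarrow> nat set set" where
  "internal_triangles n T = {t \<in> triangles n T. \<forall>i\<in>t. \<forall>j\<in>t. i \<noteq> j \<longrightarrow> \<not> is_side n i j}"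

definition disjoint_triangs :: "nat set set \<Rightarrow> nat set set \<Rightarrow> bool" where
  "disjoint_triangs T1 T2 \<longleftrightarrow> T1 \<inter> T2 = {}"

end

theory Submission
  imports Defs "HOL-Library.Infinite_Set"
begin

text \<open>The number of triangulations avoiding a set of non-crossing chords satisfies a
  deletion-contraction rule: avoiding one more chord \<open>d\<close> subtracts the product of the counts in the
  polygons on either side of \<open>d\<close>. Unfolding this rule for a triangulation \<open>T\<close> expresses the count
  through the dual tree of \<open>T\<close> alone, rooted at any of its triangles: each subtree acts linearly on
  sequences of counts, all these actions commute, and the result does not depend on the root. The
  internal triangles are the branching nodes of the dual tree, and the paths between them act through
  their lengths only, which are found by counting vertices. So two triangulations with the same
  internal triangles are compared by rooting both at a common internal triangle or, if there is none,
  at an ear.\<close>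

section \<open>Maximal independent sets of a relation\<close>

definition maximal_indep :: "('a \<Rightarrow> 'a \<Rightarrow> bool) \<Rightarrow> 'a set \<Rightarrow> 'a set \<Rightarrow> bool" where
  "maximal_indep R C T \<longleftrightarrow> T = {d \<in> C. \<forall>e\<in>T. \<not> R d e}"

definition num_avoiding :: "('a \<Rightarrow> 'a \<Rightarrow> bool) \<Rightarrow> 'a set \<Rightarrow> 'a set \<Rightarrow> int" where
  "num_avoiding R C S = int (card {T. maximal_indep R C T \<and> T \<inter> S = {}})"

definition link :: "('a \<Rightarrow> 'a \<Rightarrow> bool) \<Rightarrow> 'a \<Rightarrow> 'a set \<Rightarrow> 'a set" where
  "link R d C = {e \<in> C - {d}. \<not> R d e}"

lemma maximal_indep_subset: "maximal_indep R C T \<Longrightarrow> T \<subseteq> C"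
  unfolding maximal_indep_def by blast

lemma maximal_indepD: "maximal_indep R C T \<Longrightarrow> d \<in> T \<Longrightarrow> e \<in> T \<Longrightarrow> \<not> R d e"
  unfolding maximal_indep_def by blast

lemma maximal_indep_memI:
  "maximal_indep R C T \<Longrightarrow> d \<in> C \<Longrightarrow> (\<And>e. e \<in> T \<Longrightarrow> \<not> R d e) \<Longrightarrow> d \<in> T"
  unfolding maximal_indep_def by blast

lemma finite_maximal_indep: "finite C \<Longrightarrow> finite {T. maximal_indep R C T \<and> P T}"
  by (rule finite_subset[of _ "Pow C"]) (use maximal_indep_subset in blast, simp)

lemma num_avoiding_cong: "S \<inter> C = S' \<inter> C \<Longrightarrow> num_avoiding R C S = num_avoiding R C S'"
proof -
  assume "S \<inter> C = S' \<inter> C"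
  then have "{T. maximal_indep R C T \<and> T \<inter> S = {}} = {T. maximal_indep R C T \<and> T \<inter> S' = {}}"
    using maximal_indep_subset by blast
  then show ?thesis by (simp add: num_avoiding_def)
qed

lemma maximal_indep_insert_iff:
  assumes "symp R" "d \<in> C" "\<not> R d d" "d \<notin> T"
  shows "maximal_indep R C (insert d T) \<longleftrightarrow> maximal_indep R (link R d C) T"
proof
  assume "maximal_indep R C (insert d T)"
  then show "maximal_indep R (link R d C) T"
    using assms unfolding maximal_indep_def link_def by (blast dest: sympD)
next
  assume T: "maximal_indep R (link R d C) T"
  then have "\<not> R d e" if "e \<in> T" for e
    using that maximal_indep_subset[OF T] by (auto simp: link_def)
  with T show "maximal_indep R C (insert d T)"
    using assms unfolding maximal_indep_def link_def by (blast dest: sympD)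
qed

lemma num_avoiding_insert:
  assumes "symp R" "finite C" "d \<in> C" "\<not> R d d" "d \<notin> S"
  shows "num_avoiding R C (insert d S) = num_avoiding R C S - num_avoiding R (link R d C) S"
proof -
  let ?with = "{T. maximal_indep R C T \<and> d \<in> T \<and> T \<inter> S = {}}"
  let ?without = "{T. maximal_indep R C T \<and> T \<inter> insert d S = {}}"
  let ?link = "{T. maximal_indep R (link R d C) T \<and> T \<inter> S = {}}"
  note insert_iff = maximal_indep_insert_iff[OF assms(1,3,4)]
  have d: "d \<notin> T" if "T \<in> ?link" for T
    using that maximal_indep_subset[of R "link R d C" T] by (auto simp: link_def)
  have "bij_betw (insert d) ?link ?with"
  proof (rule bij_betw_byWitness[where f' = "\<lambda>T. T - {d}"])
    show "insert d ` ?link \<subseteq> ?with" using d insert_iff assms(5) by auto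
    show "(\<lambda>T. T - {d}) ` ?with \<subseteq> ?link"
    proof
      fix U assume "U \<in> (\<lambda>T. T - {d}) ` ?with"
      then obtain T where T: "T \<in> ?with" "U = T - {d}" by blast
      then have "insert d U = T" by blast
      then show "U \<in> ?link" using T insert_iff[of U] by auto
    qed
  qed (use d in auto)
  then have "num_avoiding R (link R d C) S = int (card ?with)"
    unfolding num_avoiding_def by (simp add: bij_betw_same_card)
  moreover have "{T. maximal_indep R C T \<and> T \<inter> S = {}} = ?with \<union> ?without" by blast
  moreover have "card (?with \<union> ?without) = card ?with + card ?without"
    using finite_maximal_indep[OF assms(2)] by (intro card_Un_disjoint) auto
  ultimately show ?thesis unfolding num_avoiding_def by simp
qed

lemma maximal_indep_Un_iff:
  assumes "A \<inter> B = {}" "\<forall>a\<in>A. \<forall>b\<in>B. \<not> R a b \<and> \<not> R b a"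
    and "T \<subseteq> A" "U \<subseteq> B"
  shows "maximal_indep R (A \<union> B) (T \<union> U) \<longleftrightarrow> maximal_indep R A T \<and> maximal_indep R B U"
proof -
  have cancel: "T \<union> U = T' \<union> U' \<longleftrightarrow> T = T' \<and> U = U'" if "T' \<subseteq> A" "U' \<subseteq> B" for T' U'
    using that assms(1,3,4) by blast
  have "{d \<in> A \<union> B. \<forall>e\<in>T \<union> U. \<not> R d e} = {d \<in> A. \<forall>e\<in>T. \<not> R d e} \<union> {d \<in> B. \<forall>e\<in>U. \<not> R d e}"
    using assms by blast
  then show ?thesis unfolding maximal_indep_def by (simp add: cancel)
qed

lemma num_avoiding_Un:
  assumes "A \<inter> B = {}" "\<forall>a\<in>A. \<forall>b\<in>B. \<not> R a b \<and> \<not> R b a"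
  shows "num_avoiding R (A \<union> B) S = num_avoiding R A S * num_avoiding R B S"
proof -
  let ?sets = "\<lambda>C. {T. maximal_indep R C T \<and> T \<inter> S = {}}"
  note indep_Un_iff = maximal_indep_Un_iff[OF assms]
  have "bij_betw (\<lambda>(T, U). T \<union> U) (?sets A \<times> ?sets B) (?sets (A \<union> B))"
  proof (rule bij_betw_byWitness[where f' = "\<lambda>T. (T \<inter> A, T \<inter> B)"])
    have split: "T \<inter> A \<union> T \<inter> B = T" if "T \<in> ?sets (A \<union> B)" for T
      using that maximal_indep_subset by blast
    then show "\<forall>T\<in>?sets (A \<union> B). (\<lambda>(T, U). T \<union> U) (T \<inter> A, T \<inter> B) = T" by simp
    show "(\<lambda>T. (T \<inter> A, T \<inter> B)) ` ?sets (A \<union> B) \<subseteq> ?sets A \<times> ?sets B"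
    proof
      fix p assume "p \<in> (\<lambda>T. (T \<inter> A, T \<inter> B)) ` ?sets (A \<union> B)"
      then obtain T where T: "T \<in> ?sets (A \<union> B)" "p = (T \<inter> A, T \<inter> B)" by blast
      then show "p \<in> ?sets A \<times> ?sets B"
        using indep_Un_iff[OF Int_lower2 Int_lower2, of T T] split[OF T(1)] by auto
    qed
    have glue: "(T \<union> U) \<inter> A = T" "(T \<union> U) \<inter> B = U" "T \<union> U \<in> ?sets (A \<union> B)"
      if "T \<in> ?sets A" "U \<in> ?sets B" for T U
    proof -
      have "T \<subseteq> A" "U \<subseteq> B" using that maximal_indep_subset by blast+
      then show "(T \<union> U) \<inter> A = T" "(T \<union> U) \<inter> B = U" "T \<union> U \<in> ?sets (A \<union> B)"
        using assms(1) that indep_Un_iff[of T U] by blast+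
    qed
    then show "(\<lambda>(T, U). T \<union> U) ` (?sets A \<times> ?sets B) \<subseteq> ?sets (A \<union> B)"
      by (intro image_subsetI) (simp only: mem_Times_iff case_prod_beta)
    show "\<forall>p\<in>?sets A \<times> ?sets B.
        ((case p of (T, U) \<Rightarrow> T \<union> U) \<inter> A, (case p of (T, U) \<Rightarrow> T \<union> U) \<inter> B) = p"
      using glue by (intro ballI) (simp add: mem_Times_iff case_prod_beta)
  qed
  from bij_betw_same_card[OF this] show ?thesis
    unfolding num_avoiding_def by (simp add: card_cartesian_product flip: of_nat_mult)
qed

lemma maximal_indep_image_iff:
  assumes "inj_on f C" "\<forall>d\<in>C. \<forall>e\<in>C. R' (f d) (f e) \<longleftrightarrow> R d e" "T \<subseteq> C"
  shows "maximal_indep R' (f ` C) (f ` T) \<longleftrightarrow> maximal_indep R C T"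
proof -
  have "{d \<in> f ` C. \<forall>e\<in>f ` T. \<not> R' d e} = f ` {d \<in> C. \<forall>e\<in>T. \<not> R d e}"
    using assms(2,3) by (auto simp: subset_iff)
  moreover have "f ` T = f ` {d \<in> C. \<forall>e\<in>T. \<not> R d e} \<longleftrightarrow> T = {d \<in> C. \<forall>e\<in>T. \<not> R d e}"
    by (rule inj_on_image_eq_iff[OF assms(1,3)]) blast
  ultimately show ?thesis unfolding maximal_indep_def by simp
qed

lemma num_avoiding_image:
  assumes "inj_on f C" "\<forall>d\<in>C. \<forall>e\<in>C. R' (f d) (f e) \<longleftrightarrow> R d e" "S \<subseteq> C"
  shows "num_avoiding R' (f ` C) (f ` S) = num_avoiding R C S"
proof -
  note image_iff = maximal_indep_image_iff[OF assms(1,2)]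
  have disjoint: "f ` T \<inter> f ` S = {} \<longleftrightarrow> T \<inter> S = {}" if "T \<subseteq> C" for T
    using inj_on_image_Int[OF assms(1) that assms(3)] by blast
  have "bij_betw ((`) f) {T. maximal_indep R C T \<and> T \<inter> S = {}}
     {T. maximal_indep R' (f ` C) T \<and> T \<inter> f ` S = {}}"
  proof (rule bij_betw_imageI)
    show "inj_on ((`) f) {T. maximal_indep R C T \<and> T \<inter> S = {}}"
      by (rule inj_on_subset[OF inj_on_image_Pow[OF assms(1)]]) (auto dest: maximal_indep_subset)
    show "(`) f ` {T. maximal_indep R C T \<and> T \<inter> S = {}}
      = {T. maximal_indep R' (f ` C) T \<and> T \<inter> f ` S = {}}" (is "_ = ?images")
    proof
      show "(`) f ` {T. maximal_indep R C T \<and> T \<inter> S = {}} \<subseteq> ?images"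
        using image_iff disjoint maximal_indep_subset[of R C] by (simp add: image_subset_iff)
      show "?images \<subseteq> (`) f ` {T. maximal_indep R C T \<and> T \<inter> S = {}}"
      proof
        fix U assume U: "U \<in> ?images"
        then have "U \<subseteq> f ` C" using maximal_indep_subset by blast
        then obtain T where "T \<subseteq> C" "U = f ` T" by (auto simp: subset_image_iff)
        then show "U \<in> (`) f ` {T. maximal_indep R C T \<and> T \<inter> S = {}}"
          using U image_iff[of T] disjoint[of T] by simp
      qed
    qed
  qed
  then show ?thesis unfolding num_avoiding_def by (simp add: bij_betw_same_card)
qed

section \<open>Chords of a finite set of points\<close>

definition segments :: "nat set \<Rightarrow> nat set set" where
  "segments V = {{a, b} | a b. a \<in> V \<and> b \<in> V \<and> a < b}"

definition chords :: "nat set \<Rightarrow> nat set set" where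
  "chords V = {d \<in> segments V. \<exists>e\<in>segments V. crosses d e}"

abbreviation num_triangs_avoiding :: "nat set \<Rightarrow> nat set set \<Rightarrow> int" where
  "num_triangs_avoiding V S \<equiv> num_avoiding crosses (chords V) S"

lemma crosses_iff:
  assumes "a < b" "c < d"
  shows "crosses {a, b} {c, d} \<longleftrightarrow> (a < c \<and> c < b \<and> b < d) \<or> (c < a \<and> a < d \<and> d < b)"
proof
  assume "crosses {a, b} {c, d}"
  then obtain p q r s where "p < r" "r < q" "q < s"
    and "({a, b} = {p, q} \<and> {c, d} = {r, s}) \<or> ({a, b} = {r, s} \<and> {c, d} = {p, q})"
    unfolding crosses_def by blast
  with assms show "(a < c \<and> c < b \<and> b < d) \<or> (c < a \<and> a < d \<and> d < b)"
    by (auto simp: doubleton_eq_iff)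
next
  assume "(a < c \<and> c < b \<and> b < d) \<or> (c < a \<and> a < d \<and> d < b)"
  then show "crosses {a, b} {c, d}" unfolding crosses_def by blast
qed

lemma symp_crosses: "symp crosses"
  unfolding crosses_def by (rule sympI) blast

lemma segmentsE:
  assumes "e \<in> segments V"
  obtains a b where "e = {a, b}" "a < b" "a \<in> V" "b \<in> V"
  using assms unfolding segments_def by blast

lemma segments_iff: "a < b \<Longrightarrow> {a, b} \<in> segments V \<longleftrightarrow> a \<in> V \<and> b \<in> V"
  unfolding segments_def by auto (metis doubleton_eq_iff less_asym)+

lemma segments_mono: "V \<subseteq> W \<Longrightarrow> segments V \<subseteq> segments W"
  unfolding segments_def by blast

lemma segments_subset_Pow: "segments V \<subseteq> Pow V"
  unfolding segments_def by blast

lemma finite_segments: "finite V \<Longrightarrow> finite (segments V)"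
  by (rule finite_subset[OF segments_subset_Pow]) simp

lemma not_crosses_self: "e \<in> segments V \<Longrightarrow> \<not> crosses e e"
  by (elim segmentsE) (simp add: crosses_iff)

lemma chords_subset_segments: "chords V \<subseteq> segments V"
  unfolding chords_def by blast

lemma chordsE:
  assumes "e \<in> chords V"
  obtains a b where "e = {a, b}" "a < b"
  using assms chords_subset_segments by (blast elim: segmentsE)

lemma chords_mono: "V \<subseteq> W \<Longrightarrow> chords V \<subseteq> chords W"
  unfolding chords_def using segments_mono by blast

lemma chords_iff:
  assumes "a < b"
  shows "{a, b} \<in> chords V \<longleftrightarrow>
    a \<in> V \<and> b \<in> V \<and> (\<exists>x\<in>V. a < x \<and> x < b) \<and> (\<exists>y\<in>V. y < a \<or> b < y)"
proof
  assume "{a, b} \<in> chords V"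
  then obtain c d where "{a, b} \<in> segments V" "c \<in> V" "d \<in> V" "c < d" "crosses {a, b} {c, d}"
    unfolding chords_def by (blast elim: segmentsE)
  then show "a \<in> V \<and> b \<in> V \<and> (\<exists>x\<in>V. a < x \<and> x < b) \<and> (\<exists>y\<in>V. y < a \<or> b < y)"
    using assms by (auto simp: crosses_iff segments_iff)
next
  assume "a \<in> V \<and> b \<in> V \<and> (\<exists>x\<in>V. a < x \<and> x < b) \<and> (\<exists>y\<in>V. y < a \<or> b < y)"
  then obtain x y where V: "a \<in> V" "b \<in> V" and x: "x \<in> V" "a < x" "x < b"
    and y: "y \<in> V" "y < a \<or> b < y"
    by blast
  have "{min x y, max x y} \<in> segments V" "crosses {a, b} {min x y, max x y}"
    using x y by (auto simp: min_def max_def segments_iff crosses_iff)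
  then show "{a, b} \<in> chords V" using assms V by (auto simp: chords_def segments_iff)
qed

section \<open>Cutting along a chord\<close>

lemma chord_inside:
  assumes "a \<in> V" "b \<in> V" "p < q" "{p, q} \<in> chords V" "a \<le> p" "q \<le> b" "{p, q} \<noteq> {a, b}"
  shows "{p, q} \<in> chords (V \<inter> {a..b})"
proof -
  obtain x where "p \<in> V" "q \<in> V" "x \<in> V" "p < x" "x < q"
    using assms(4) chords_iff[OF assms(3)] by blast
  moreover have "a < p \<or> q < b" using assms by auto
  ultimately show ?thesis unfolding chords_iff[OF assms(3)] using assms by force
qed

lemma chord_outside:
  assumes "a \<in> V" "b \<in> V" "p < q" "{p, q} \<in> chords V" "{p, q} \<noteq> {a, b}"
    and "q \<le> a \<or> b \<le> p \<or> (p \<le> a \<and> b \<le> q)" "a < b"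
  shows "{p, q} \<in> chords (V - {a<..<b})"
proof -
  obtain x y where V: "p \<in> V" "q \<in> V" and x: "x \<in> V" "p < x" "x < q" and y: "y \<in> V" "y < p \<or> q < y"
    using assms(4) chords_iff[OF assms(3)] by blast
  have "\<exists>z\<in>V - {a<..<b}. p < z \<and> z < q"
  proof (cases "x \<in> {a<..<b}")
    case True
    then have "(p < a \<and> a < q) \<or> (p < b \<and> b < q)" using x assms by auto
    then show ?thesis using assms by auto
  qed (use x in auto)
  moreover have "\<exists>z\<in>V - {a<..<b}. z < p \<or> q < z"
  proof (cases "y \<in> {a<..<b}")
    case True
    then have "a < p \<or> q < b" using y assms by auto
    then show ?thesis using assms by (metis DiffI greaterThanLessThan_iff less_irrefl)
  qed (use y in auto)
  ultimately show ?thesis unfolding chords_iff[OF assms(3)] using V assms by auto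
qed

lemma not_crosses_inside_outside:
  assumes "d \<in> segments (V \<inter> {a..b})" "e \<in> segments (V - {a<..<b})"
  shows "\<not> crosses d e"
  using assms by (elim segmentsE) (auto simp: crosses_iff)

lemma chords_inside_Int_outside: "chords (V \<inter> {a..b}) \<inter> chords (V - {a<..<b}) = {}"
proof (rule equals0I)
  fix e assume e: "e \<in> chords (V \<inter> {a..b}) \<inter> chords (V - {a<..<b})"
  then obtain p q where "e = {p, q}" "p < q" by (blast elim: chordsE)
  with e show False by (auto simp: chords_iff)
qed

lemma link_chords:
  assumes "a \<in> V" "b \<in> V" "a < b"
  shows "link crosses {a, b} (chords V) = chords (V \<inter> {a..b}) \<union> chords (V - {a<..<b})"
proof (intro equalityI subsetI)
  fix e assume e: "e \<in> link crosses {a, b} (chords V)"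
  then obtain p q where pq: "e = {p, q}" "p < q"
    unfolding link_def by (blast elim: chordsE)
  then have "\<not> (a < p \<and> p < b \<and> b < q)" "\<not> (p < a \<and> a < q \<and> q < b)"
    using e assms(3) by (auto simp: link_def crosses_iff)
  then have "a \<le> p \<and> q \<le> b \<or> q \<le> a \<or> b \<le> p \<or> (p \<le> a \<and> b \<le> q)" using pq(2) by linarith
  then show "e \<in> chords (V \<inter> {a..b}) \<union> chords (V - {a<..<b})"
    using e assms chord_inside[OF assms(1,2) pq(2)] chord_outside[OF assms(1,2) pq(2)]
    unfolding pq(1) link_def by blast
next
  fix e assume e: "e \<in> chords (V \<inter> {a..b}) \<union> chords (V - {a<..<b})"
  have "chords (V \<inter> {a..b}) \<subseteq> chords V" "chords (V - {a<..<b}) \<subseteq> chords V"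
    by (intro chords_mono; blast)+
  then have "e \<in> chords V" using e by blast
  moreover have "\<not> crosses {a, b} e \<and> e \<noteq> {a, b}"
  proof -
    obtain p q where pq: "e = {p, q}" "p < q" using e by (blast elim: chordsE)
    then show ?thesis using e assms(3) by (auto simp: chords_iff crosses_iff doubleton_eq_iff)
  qed
  ultimately show "e \<in> link crosses {a, b} (chords V)" by (simp add: link_def)
qed

lemma num_triangs_avoiding_insert:
  assumes "finite V" "a < b" "{a, b} \<in> chords V" "{a, b} \<notin> S"
  shows "num_triangs_avoiding V (insert {a, b} S) =
    num_triangs_avoiding V S
      - num_triangs_avoiding (V \<inter> {a..b}) S * num_triangs_avoiding (V - {a<..<b}) S"
proof -
  have V: "a \<in> V" "b \<in> V" using assms(3) chords_iff[OF assms(2)] by auto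
  have "finite (chords V)"
    using finite_segments[OF assms(1)] chords_subset_segments by (rule rev_finite_subset)
  moreover have "\<not> crosses {a, b} {a, b}" using assms(2) by (simp add: crosses_iff)
  ultimately have "num_triangs_avoiding V (insert {a, b} S) = num_triangs_avoiding V S
      - num_avoiding crosses (chords (V \<inter> {a..b}) \<union> chords (V - {a<..<b})) S"
    using assms(3,4) unfolding link_chords[OF V assms(2), symmetric]
    by (intro num_avoiding_insert symp_crosses)
  moreover have "\<forall>d\<in>chords (V \<inter> {a..b}). \<forall>e\<in>chords (V - {a<..<b}). \<not> crosses d e \<and> \<not> crosses e d"
    using not_crosses_inside_outside chords_subset_segments symp_crosses by (meson subsetD sympD)
  ultimately show ?thesis by (simp add: num_avoiding_Un chords_inside_Int_outside)
qed

section \<open>The number of triangulations depends only on the number of vertices\<close>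

lemma segments_image:
  assumes "strict_mono_on V (h :: nat \<Rightarrow> nat)"
  shows "segments (h ` V) = (`) h ` segments V"
proof (intro equalityI subsetI)
  fix e assume "e \<in> segments (h ` V)"
  then obtain a b where "e = h ` {a, b}" "h a < h b" "a \<in> V" "b \<in> V"
    by (elim segmentsE) auto
  then show "e \<in> (`) h ` segments V"
    using assms strict_mono_on_less by (metis image_eqI segments_iff)
next
  fix e assume "e \<in> (`) h ` segments V"
  then show "e \<in> segments (h ` V)"
    using assms by (auto elim!: segmentsE simp: segments_iff strict_mono_on_less)
qed

lemma crosses_image_iff:
  assumes "strict_mono_on V (h :: nat \<Rightarrow> nat)" "d \<in> segments V" "e \<in> segments V"
  shows "crosses (h ` d) (h ` e) \<longleftrightarrow> crosses d e"
  using assms(2,3) by (elim segmentsE) (simp add: crosses_iff strict_mono_on_less[OF assms(1)])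

lemma chords_image:
  assumes "strict_mono_on V (h :: nat \<Rightarrow> nat)"
  shows "chords (h ` V) = (`) h ` chords V"
  unfolding chords_def segments_image[OF assms] using crosses_image_iff[OF assms] by auto

definition num_triangs :: "nat \<Rightarrow> int" where
  "num_triangs m = num_triangs_avoiding {..<m + 2} {}"

lemma num_triangs_avoiding_empty:
  assumes "finite V" "card V = m + 2"
  shows "num_triangs_avoiding V {} = num_triangs m"
proof -
  obtain h where h: "bij_betw h {..<m + 2} V" "strict_mono_on {..<m + 2} h"
    using ex_bij_betw_strict_mono_card[OF assms(1)] unfolding assms(2) .
  have "chords {..<m + 2} \<subseteq> Pow {..<m + 2}"
    using chords_subset_segments segments_subset_Pow by (rule subset_trans)
  with inj_on_image_Pow[OF bij_betw_imp_inj_on[OF h(1)]]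
  have "inj_on ((`) h) (chords {..<m + 2})" by (rule inj_on_subset)
  then have "num_avoiding crosses ((`) h ` chords {..<m + 2}) ((`) h ` {}) = num_triangs m"
    unfolding num_triangs_def
    using crosses_image_iff[OF h(2)] chords_subset_segments by (intro num_avoiding_image) auto
  then show ?thesis using chords_image[OF h(2)] bij_betw_imp_surj_on[OF h(1)] by simp
qed

section \<open>Binary trees and their action on counting profiles\<close>

datatype btree = Leaf | Node btree btree

abbreviation last_point :: "nat \<Rightarrow> btree \<Rightarrow> nat" where
  "last_point i t \<equiv> i + size t + 1"

text \<open>A tree with \<open>k\<close> nodes stands for a triangulation of the points \<open>i, \<dots>, i + k + 1\<close>. Its root is
  the triangle resting on the segment from \<open>i\<close> to \<open>i + k + 1\<close>; a leaf is a segment joining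
  consecutive points.\<close>

fun edges :: "nat \<Rightarrow> btree \<Rightarrow> nat set set" where
  "edges i Leaf = {{i, last_point i Leaf}}"
| "edges i (Node l r) = insert {i, last_point i (Node l r)} (edges i l \<union> edges (last_point i l) r)"

text \<open>Let \<open>f k\<close> be the number of triangulations avoiding a given set of chords, when \<open>k\<close> further
  points are present. Then \<open>profile_map t f\<close> is the corresponding function once \<open>t\<close> has been placed
  on some of these points and its edges are avoided as well. The edge below a node is treated by
  deletion: without it the root triangle belongs to the cell below, which gains a point; with it the
  polygon above is split off.\<close>

fun profile_map :: "btree \<Rightarrow> (nat \<Rightarrow> int) \<Rightarrow> nat \<Rightarrow> int" where
  "profile_map Leaf f k = f k"
| "profile_map (Node l r) f k =
    profile_map l (profile_map r f) (Suc k) - profile_map l (profile_map r num_triangs) 1 * f k"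

lemma profile_map_Leaf: "profile_map Leaf f = f"
  by (rule ext) simp

lemma profile_map_Node:
  "profile_map (Node l r) f = (\<lambda>k. profile_map l (profile_map r f) (Suc k)
    - profile_map l (profile_map r num_triangs) 1 * f k)"
  by (rule ext) simp

lemma profile_map_diff:
  "profile_map t (\<lambda>k. f k - c * g k) = (\<lambda>k. profile_map t f k - c * profile_map t g k)"
  by (induction t arbitrary: f g c) (simp_all add: profile_map_Leaf profile_map_Node algebra_simps)

lemma profile_map_Suc: "profile_map t (\<lambda>k. f (Suc k)) = (\<lambda>k. profile_map t f (Suc k))"
  by (induction t arbitrary: f) (simp_all add: profile_map_Leaf profile_map_Node)

lemma profile_map_commute: "profile_map s (profile_map t f) = profile_map t (profile_map s f)"
  by (induction t arbitrary: f)
    (simp_all add: profile_map_Leaf profile_map_Node profile_map_diff profile_map_Suc)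

lemma profile_map_Node_commute: "profile_map (Node l r) = profile_map (Node r l)"
  by (intro ext) (simp add: profile_map_commute[of l r])

section \<open>Triangulations avoiding the edges of a tree\<close>

text \<open>Of the points, those in \<open>W\<close> are present and those in \<open>P\<close> optional.\<close>

definition has_profile :: "nat set \<Rightarrow> nat set set \<Rightarrow> nat set \<Rightarrow> (nat \<Rightarrow> int) \<Rightarrow> bool" where
  "has_profile W S P f \<longleftrightarrow> (\<forall>X\<subseteq>P. num_triangs_avoiding (W \<union> X) S = f (card X))"

definition vacant :: "nat set \<Rightarrow> nat set set \<Rightarrow> nat set \<Rightarrow> nat \<Rightarrow> nat \<Rightarrow> bool" where
  "vacant W S P i j \<longleftrightarrow> finite W \<and> finite P \<and> W \<inter> P = {} \<and> i \<in> W \<and> j \<in> W \<and> {i<..<j} \<subseteq> P \<and>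
     (\<forall>e\<in>S. \<not> e \<subseteq> {i..j})"

definition acts_on_profiles :: "btree \<Rightarrow> bool" where
  "acts_on_profiles t \<longleftrightarrow> (\<forall>W S P f i j. j = last_point i t \<longrightarrow> vacant W S P i j \<longrightarrow> W \<noteq> {i, j} \<longrightarrow>
     has_profile W S P f \<longrightarrow>
     has_profile (W \<union> {i<..<j}) (S \<union> edges i t) (P - {i<..<j}) (profile_map t f))"

lemma edges_subset_segments: "edges i t \<subseteq> segments {i..last_point i t}"
proof (induction t arbitrary: i)
  case (Node l r)
  have "segments {i..last_point i l} \<subseteq> segments {i..last_point i (Node l r)}"
    "segments {last_point i l..last_point (last_point i l) r}
      \<subseteq> segments {i..last_point i (Node l r)}"
    by (rule segments_mono, simp)+
  moreover have "{i, last_point i (Node l r)} \<in> segments {i..last_point i (Node l r)}"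
    by (subst segments_iff) simp_all
  ultimately show ?case using Node[of i] Node[of "last_point i l"] unfolding edges.simps by blast
qed (simp add: segments_iff)

lemma edgesE:
  assumes "e \<in> edges i t"
  obtains a b where "e = {a, b}" "i \<le> a" "a < b" "b \<le> last_point i t"
  using assms edges_subset_segments[of i t] by (fastforce elim: segmentsE)

lemma edges_pair_inside:
  assumes m: "m = last_point i l" and j: "j = last_point m r"
  shows "edges i l \<union> edges m r \<subseteq> segments {i..j}" "{i, j} \<notin> edges i l \<union> edges m r"
proof -
  have "segments {i..m} \<subseteq> segments {i..j}" "segments {m..j} \<subseteq> segments {i..j}"
    using m j by (auto intro!: segments_mono)
  then show "edges i l \<union> edges m r \<subseteq> segments {i..j}"
    using edges_subset_segments[of i l] edges_subset_segments[of m r] m j by blast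
  show "{i, j} \<notin> edges i l \<union> edges m r"
    using m j edges_subset_segments[of i l] edges_subset_segments[of m r]
    by (auto dest!: subsetD simp: segments_iff)
qed

lemma has_profile_insert:
  assumes "has_profile W S P f" "m \<in> P" "finite P"
  shows "has_profile (insert m W) S (P - {m}) (\<lambda>k. f (Suc k))"
  unfolding has_profile_def
proof (intro allI impI)
  fix X assume X: "X \<subseteq> P - {m}"
  then have "card (insert m X) = Suc (card X)"
    using finite_subset[OF _ assms(3), of X] by (subst card_insert_disjoint) auto
  moreover have "insert m X \<subseteq> P" using X assms(2) by blast
  ultimately show "num_triangs_avoiding (insert m W \<union> X) S = f (Suc (card X))"
    using assms(1) unfolding has_profile_def by (metis Un_insert_left Un_insert_right)
qed

lemma has_profile_pair:
  assumes l: "acts_on_profiles l" and r: "acts_on_profiles r"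
    and m: "m = last_point i l" and j: "j = last_point m r"
    and vacant: "vacant W S P i j" and profile: "has_profile W S P f"
  shows "has_profile (W \<union> {i<..<j}) (S \<union> edges i l \<union> edges m r) (P - {i<..<j})
    (\<lambda>k. profile_map l (profile_map r f) (Suc k))"
proof -
  let ?Wm = "insert m W" and ?Pm = "P - {m}"
  have ij: "i < m" "m < j" using m j by auto
  have W: "finite W" "finite P" "W \<inter> P = {}" "i \<in> W" "j \<in> W" "{i<..<j} \<subseteq> P"
    and S: "\<forall>e\<in>S. \<not> e \<subseteq> {i..j}" using vacant by (auto simp: vacant_def)
  have mP: "m \<in> P" using ij W by auto
  have S_parts: "\<not> e \<subseteq> {i..m}" "\<not> e \<subseteq> {m..j}" if "e \<in> S" for e
    using S that ij by (meson atLeastatMost_subset_iff less_imp_le order_refl subset_trans)+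
  have l_edges: "\<not> e \<subseteq> {m..j}" if "e \<in> edges i l" for e
    using that by (rule edgesE) (use m in auto)
  have "has_profile ?Wm S ?Pm (\<lambda>k. f (Suc k))"
    using has_profile_insert[OF profile mP W(2)] .
  moreover have "vacant ?Wm S ?Pm i m"
    using W ij S_parts unfolding vacant_def by auto
  moreover have "?Wm \<noteq> {i, m}"
    using W(5) ij by (metis insertCI insertE less_irrefl less_trans singletonD)
  ultimately have "has_profile (?Wm \<union> {i<..<m}) (S \<union> edges i l) (?Pm - {i<..<m})
      (profile_map l (\<lambda>k. f (Suc k)))"
    using l m unfolding acts_on_profiles_def by blast
  moreover have "vacant (?Wm \<union> {i<..<m}) (S \<union> edges i l) (?Pm - {i<..<m}) m j"
    using W ij S_parts l_edges unfolding vacant_def by auto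
  moreover have "?Wm \<union> {i<..<m} \<noteq> {m, j}"
    using W(4) ij by (metis UnI1 insertCI insertE less_irrefl less_trans singletonD)
  ultimately have "has_profile (?Wm \<union> {i<..<m} \<union> {m<..<j}) (S \<union> edges i l \<union> edges m r)
      (?Pm - {i<..<m} - {m<..<j}) (profile_map r (profile_map l (\<lambda>k. f (Suc k))))"
    using r j unfolding acts_on_profiles_def by blast
  moreover have "?Wm \<union> {i<..<m} \<union> {m<..<j} = W \<union> {i<..<j}"
    and "?Pm - {i<..<m} - {m<..<j} = P - {i<..<j}" using ij by auto
  moreover have "profile_map r (profile_map l (\<lambda>k. f (Suc k)))
      = (\<lambda>k. profile_map l (profile_map r f) (Suc k))"
    by (simp add: profile_map_Suc profile_map_commute[of r l])
  ultimately show ?thesis by simp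
qed

lemma num_triangs_avoiding_pair:
  assumes "acts_on_profiles l" "acts_on_profiles r"
    and m: "m = last_point i l" and j: "j = last_point m r"
  shows "num_triangs_avoiding {i..j} (edges i l \<union> edges m r)
    = profile_map l (profile_map r num_triangs) 1"
proof -
  have ij: "i < j" using m j by simp
  have "has_profile {i, j} {} {i<..<j} num_triangs"
    unfolding has_profile_def
  proof (intro allI impI)
    fix X assume X: "X \<subseteq> {i<..<j}"
    then have "finite X" "i \<notin> X" "j \<notin> X" using finite_subset by auto
    then show "num_triangs_avoiding ({i, j} \<union> X) {} = num_triangs (card X)"
      using ij by (intro num_triangs_avoiding_empty) auto
  qed
  moreover have "vacant {i, j} {} {i<..<j} i j" by (auto simp: vacant_def)
  ultimately have "has_profile ({i, j} \<union> {i<..<j}) ({} \<union> edges i l \<union> edges m r)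
      ({i<..<j} - {i<..<j}) (\<lambda>k. profile_map l (profile_map r num_triangs) (Suc k))"
    by (intro has_profile_pair assms)
  moreover have "{i, j} \<union> {i<..<j} = {i..j}" using ij by auto
  ultimately show ?thesis by (simp add: has_profile_def)
qed

lemma num_triangs_avoiding_insert_base:
  assumes W: "finite W" "i \<in> W" "j \<in> W" "W \<inter> {i<..<j} = {}" "W \<noteq> {i, j}" and ij: "i + 1 < j"
    and S: "\<forall>e\<in>S. \<not> e \<subseteq> {i..j}" and E: "E \<subseteq> segments {i..j}" "{i, j} \<notin> E"
  shows "num_triangs_avoiding (W \<union> {i<..<j}) (insert {i, j} (S \<union> E)) =
    num_triangs_avoiding (W \<union> {i<..<j}) (S \<union> E)
      - num_triangs_avoiding {i..j} E * num_triangs_avoiding W S"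
proof -
  let ?V = "W \<union> {i<..<j}"
  obtain w where w: "w \<in> W" "w \<noteq> i" "w \<noteq> j" using W by blast
  then have "w < i \<or> j < w"
    using W(4) by (metis disjoint_iff greaterThanLessThan_iff linorder_neqE_nat)
  then have "{i, j} \<in> chords ?V"
    using W ij w by (subst chords_iff) (auto intro: bexI[of _ "i + 1"])
  then have "num_triangs_avoiding ?V (insert {i, j} (S \<union> E)) = num_triangs_avoiding ?V (S \<union> E)
      - num_triangs_avoiding (?V \<inter> {i..j}) (S \<union> E) * num_triangs_avoiding (?V - {i<..<j}) (S \<union> E)"
    using W ij S E by (intro num_triangs_avoiding_insert) auto
  moreover have "?V \<inter> {i..j} = {i..j}" using W(2,3) by (auto simp: le_less)
  moreover have "?V - {i<..<j} = W" using W(4) by blast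
  moreover have "num_triangs_avoiding {i..j} (S \<union> E) = num_triangs_avoiding {i..j} E"
    using S segments_subset_Pow chords_subset_segments[of "{i..j}"]
    by (intro num_avoiding_cong) blast
  moreover have "num_triangs_avoiding W (S \<union> E) = num_triangs_avoiding W S"
  proof (rule num_avoiding_cong)
    have "e \<notin> chords W" if "e \<in> E" for e
    proof
      assume "e \<in> chords W"
      moreover obtain a b where ab: "e = {a, b}" "a < b" "a \<in> {i..j}" "b \<in> {i..j}"
        using E(1) \<open>e \<in> E\<close> by (blast elim: segmentsE)
      ultimately have "a \<notin> {i<..<j}" "b \<notin> {i<..<j}" using W(4) by (auto simp: chords_iff)
      then have "e = {i, j}" using ab by auto
      with E(2) that show False by blast
    qed
    then show "(S \<union> E) \<inter> chords W = S \<inter> chords W" by blast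
  qed
  ultimately show ?thesis by simp
qed

lemma acts_on_profiles_Node:
  assumes l: "acts_on_profiles l" and r: "acts_on_profiles r"
  shows "acts_on_profiles (Node l r)"
  unfolding acts_on_profiles_def
proof (intro allI impI)
  fix W S P f i j
  assume j_Node: "j = last_point i (Node l r)" and vacant: "vacant W S P i j"
    and nontrivial: "W \<noteq> {i, j}" and profile: "has_profile W S P f"
  define m where m: "m = last_point i l"
  have j: "j = last_point m r" using j_Node m by simp
  have ij: "i < m" "m < j" using m j by auto
  have W: "finite W" "finite P" "W \<inter> P = {}" "i \<in> W" "j \<in> W" "{i<..<j} \<subseteq> P"
    and S: "\<forall>e\<in>S. \<not> e \<subseteq> {i..j}" using vacant by (auto simp: vacant_def)
  let ?E = "edges i l \<union> edges m r"
  have edges_Node: "edges i (Node l r) = insert {i, j} ?E" using m j_Node by simp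
  show "has_profile (W \<union> {i<..<j}) (S \<union> edges i (Node l r)) (P - {i<..<j})
    (profile_map (Node l r) f)"
    unfolding has_profile_def
  proof (intro allI impI)
    fix X assume X: "X \<subseteq> P - {i<..<j}"
    let ?V = "W \<union> X \<union> {i<..<j}"
    have "finite (W \<union> X)" using W X finite_subset[of X P] by auto
    moreover have "i \<in> W \<union> X" "j \<in> W \<union> X" "(W \<union> X) \<inter> {i<..<j} = {}" "W \<union> X \<noteq> {i, j}"
      using nontrivial W X by blast+
    ultimately have "num_triangs_avoiding ?V (insert {i, j} (S \<union> ?E))
        = num_triangs_avoiding ?V (S \<union> ?E)
          - num_triangs_avoiding {i..j} ?E * num_triangs_avoiding (W \<union> X) S"
      using S edges_pair_inside[OF m j] ij by (intro num_triangs_avoiding_insert_base) auto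
    moreover have "?V = W \<union> {i<..<j} \<union> X" "S \<union> ?E = S \<union> edges i l \<union> edges m r" by blast+
    moreover have "num_triangs_avoiding (W \<union> {i<..<j} \<union> X) (S \<union> edges i l \<union> edges m r)
        = profile_map l (profile_map r f) (Suc (card X))"
      using has_profile_pair[OF l r m j vacant profile] X unfolding has_profile_def by blast
    moreover have "num_triangs_avoiding (W \<union> X) S = f (card X)"
      using profile X unfolding has_profile_def by blast
    ultimately show "num_triangs_avoiding (W \<union> {i<..<j} \<union> X) (S \<union> edges i (Node l r))
        = profile_map (Node l r) f (card X)"
      using num_triangs_avoiding_pair[OF l r m j] unfolding edges_Node by simp
  qed
qed

lemma acts_on_profiles: "acts_on_profiles t"
proof (induction t)
  case Leaf
  have "{i<..<Suc i} = {}" for i :: nat by auto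
  moreover have "num_triangs_avoiding V (S \<union> {{i, Suc i}}) = num_triangs_avoiding V S" for V S i
    using chords_iff[of i "Suc i" V] by (intro num_avoiding_cong) auto
  ultimately show ?case by (simp add: acts_on_profiles_def has_profile_def)
qed (rule acts_on_profiles_Node)

section \<open>Branchings determine the action of a tree\<close>

fun cells :: "nat \<Rightarrow> btree \<Rightarrow> nat set set" where
  "cells i Leaf = {}"
| "cells i (Node l r) =
    insert {i, last_point i l, last_point i (Node l r)} (cells i l \<union> cells (last_point i l) r)"

definition branchings :: "nat \<Rightarrow> btree \<Rightarrow> nat set set" where
  "branchings i t = {x \<in> cells i t. \<forall>k\<in>x. Suc k \<notin> x}"

fun branching :: "btree \<Rightarrow> bool" where
  "branching Leaf = False"
| "branching (Node l r) = (l \<noteq> Leaf \<and> r \<noteq> Leaf)"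

lemma size_eq_0_iff_Leaf: "size t = 0 \<longleftrightarrow> t = Leaf"
  by (cases t) auto

lemma branchings_Leaf [simp]: "branchings i Leaf = {}"
  by (simp add: branchings_def)

lemma branchings_Node:
  "branchings i (Node l r) =
    (if branching (Node l r) then {{i, last_point i l, last_point i (Node l r)}} else {}) \<union>
    branchings i l \<union> branchings (last_point i l) r"
proof -
  define root where "root = {i, last_point i l, last_point i (Node l r)}"
  have "(\<forall>k\<in>root. Suc k \<notin> root) \<longleftrightarrow> branching (Node l r)"
    using size_eq_0_iff_Leaf[of l] size_eq_0_iff_Leaf[of r] unfolding root_def by auto
  then show ?thesis unfolding branchings_def cells.simps root_def[symmetric] by auto
qed

lemma cellsE:
  assumes "x \<in> cells i t"
  obtains a b c where "x = {a, b, c}" "i \<le> a" "a < b" "b < c" "c \<le> last_point i t"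
proof -
  have "\<exists>a b c. x = {a, b, c} \<and> i \<le> a \<and> a < b \<and> b < c \<and> c \<le> last_point i t"
    using assms
  proof (induction t arbitrary: i)
    case (Node l r)
    let ?m = "last_point i l" and ?j = "last_point i (Node l r)"
    consider "x = {i, ?m, ?j}" | "x \<in> cells i l" | "x \<in> cells ?m r" using Node.prems by auto
    then show ?case
    proof cases
      case 1
      moreover have "i < ?m" "?m < ?j" by simp_all
      ultimately show ?thesis by blast
    next
      case 2
      moreover have "?m \<le> ?j" by simp
      ultimately show ?thesis using Node.IH(1) by (meson order_trans)
    next
      case 3
      moreover have "i \<le> ?m" "last_point ?m r \<le> ?j" by simp_all
      ultimately show ?thesis using Node.IH(2) by (meson order_trans)
    qed
  qed simp
  then show thesis using that by blast
qed

lemma branchingsE: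
  assumes "x \<in> branchings i t"
  obtains a b c where "x = {a, b, c}" "i \<le> a" "a < b" "b < c" "c \<le> last_point i t"
  using assms unfolding branchings_def by (blast elim: cellsE)

lemma branchings_subset: "x \<in> branchings i t \<Longrightarrow> x \<subseteq> {i..last_point i t}"
  by (erule branchingsE) auto

lemma branchings_Node_left:
  "branchings i l = {x \<in> branchings i (Node l r). x \<subseteq> {..last_point i l}}"
proof -
  have "k \<le> last_point i l" if "x \<in> branchings i l" "k \<in> x" for x k
    using that by (auto elim!: branchingsE)
  moreover have "\<not> x \<subseteq> {..last_point i l}" if "x \<in> branchings (last_point i l) r" for x
    using that by (auto elim!: branchingsE)
  ultimately show ?thesis unfolding branchings_Node by auto
qed

lemma branchings_Node_right:
  "branchings (last_point i l) r = {x \<in> branchings i (Node l r). x \<subseteq> {last_point i l..}}"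
proof -
  have "last_point i l \<le> k" if "x \<in> branchings (last_point i l) r" "k \<in> x" for x k
    using that by (auto elim!: branchingsE)
  moreover have "\<not> x \<subseteq> {last_point i l..}" if "x \<in> branchings i l" for x
    using that by (auto elim!: branchingsE)
  ultimately show ?thesis unfolding branchings_Node by auto
qed

lemma branchings_Node_root:
  assumes "branching (Node l r)"
  shows "{x \<in> branchings i (Node l r). {i, last_point i (Node l r)} \<subseteq> x}
    = {{i, last_point i l, last_point i (Node l r)}}"
proof -
  have "last_point i (Node l r) \<notin> x" if "x \<in> branchings i l" for x
    using that by (auto elim!: branchingsE)
  moreover have "i \<notin> x" if "x \<in> branchings (last_point i l) r" for x
    using that by (auto elim!: branchingsE)
  ultimately show ?thesis using assms unfolding branchings_Node by auto
qed

lemma branchings_Node_eqD: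
  assumes eq: "branchings i (Node l r) = branchings i (Node l' r')"
    and size: "size (Node l r) = size (Node l' r')"
    and branching: "branching (Node l r)" "branching (Node l' r')"
  shows "size l = size l'" "size r = size r'" "branchings i l = branchings i l'"
    "branchings (last_point i l) r = branchings (last_point i l) r'"
proof -
  have "{{i, last_point i l, last_point i (Node l r)}}
      = {{i, last_point i l', last_point i (Node l' r')}}"
    using branchings_Node_root[OF branching(1), of i] branchings_Node_root[OF branching(2), of i]
    unfolding eq size by (rule trans[OF sym])
  then have "last_point i l \<in> {i, last_point i l', last_point i (Node l' r')}" by blast
  then show l: "size l = size l'" using size by auto
  then show "size r = size r'" using size by simp
  show "branchings i l = branchings i l'"
    using branchings_Node_left[of i l r] branchings_Node_left[of i l' r'] by (simp only: eq l)
  show "branchings (last_point i l) r = branchings (last_point i l) r'"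
    using branchings_Node_right[of i l r] branchings_Node_right[of i l' r'] by (simp only: eq l)
qed

lemma branching_root_cell:
  assumes "branching t"
  obtains m where "{i, m, last_point i t} \<in> branchings i t"
proof -
  obtain l r where "t = Node l r" using assms by (cases t) auto
  then show thesis using that[of "last_point i l"] assms by (simp add: branchings_Node)
qed

lemma branchings_subset_extent:
  assumes "branching s" "branchings i s \<subseteq> branchings j t"
  shows "j \<le> i" "last_point i s \<le> last_point j t"
proof -
  obtain m where "{i, m, last_point i s} \<in> branchings i s" using branching_root_cell[OF assms(1)] .
  then have "{i, last_point i s} \<subseteq> {j..last_point j t}"
    using assms(2) branchings_subset[of _ j t] by blast
  then show "j \<le> i" "last_point i s \<le> last_point j t" by auto
qed

definition lengthen :: "((nat \<Rightarrow> int) \<Rightarrow> nat \<Rightarrow> int) \<Rightarrow> (nat \<Rightarrow> int) \<Rightarrow> nat \<Rightarrow> int" where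
  "lengthen L f k = L f (Suc k) - L num_triangs 1 * f k"

lemma profile_map_Node_Leaf: "profile_map (Node t Leaf) = lengthen (profile_map t)"
  by (intro ext) (simp add: lengthen_def profile_map_Leaf)

lemma profile_map_non_branching:
  assumes "\<not> branching (Node l r)"
  obtains u k where "u \<in> {l, r}" "profile_map (Node l r) = lengthen (profile_map u)"
    "size (Node l r) = Suc (size u)" "branchings i (Node l r) = branchings k u"
proof (cases "r = Leaf")
  case True
  then show ?thesis
    using that[of l i] by (simp add: profile_map_Node_Leaf branchings_Node del: profile_map.simps)
next
  case False
  then have "l = Leaf" using assms by simp
  then show ?thesis
    using that[of r "last_point i l"]
    by (simp add: profile_map_Node_commute[of Leaf] profile_map_Node_Leaf branchings_Node
        del: profile_map.simps)
qed

text \<open>Triangles with a side on the boundary only lengthen the path leading to the first branching.\<close>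

lemma profile_map_trunk:
  obtains s k where "s = Leaf \<or> branching s" "branchings k s = branchings i t" "size s \<le> size t"
    "profile_map t = (lengthen ^^ (size t - size s)) (profile_map s)"
proof -
  have "\<exists>s k. (s = Leaf \<or> branching s) \<and> branchings k s = branchings i t \<and> size s \<le> size t \<and>
    profile_map t = (lengthen ^^ (size t - size s)) (profile_map s)"
  proof (induction "size t" arbitrary: i t rule: less_induct)
    case less
    show ?case
    proof (cases "t = Leaf \<or> branching t")
      case True
      then show ?thesis by (intro exI[of _ t] exI[of _ i]) simp
    next
      case False
      then obtain l r where t: "t = Node l r" "\<not> branching (Node l r)" by (cases t) auto
      then obtain u k where u: "profile_map t = lengthen (profile_map u)" "size t = Suc (size u)"
        "branchings i t = branchings k u"
        using profile_map_non_branching[OF t(2), of i] by metis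
      with less obtain s k' where s: "s = Leaf \<or> branching s" "branchings k' s = branchings k u"
        "size s \<le> size u" "profile_map u = (lengthen ^^ (size u - size s)) (profile_map s)"
        by (metis lessI)
      have "size t - size s = Suc (size u - size s)" using u(2) s(3) by simp
      then have "profile_map t = (lengthen ^^ (size t - size s)) (profile_map s)"
        using s(4) u(1) by simp
      then show ?thesis using s(1-3) u(2,3) by (intro exI[of _ s] exI[of _ k']) simp
    qed
  qed
  then show thesis using that by blast
qed

lemma profile_map_eqI:
  "size t = size t' \<Longrightarrow> branchings i t = branchings j t' \<Longrightarrow> profile_map t = profile_map t'"
proof (induction "size t" arbitrary: i j t t' rule: less_induct)
  case less
  obtain s k where s: "s = Leaf \<or> branching s" "branchings k s = branchings i t" "size s \<le> size t"
    "profile_map t = (lengthen ^^ (size t - size s)) (profile_map s)"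
    using profile_map_trunk .
  obtain s' k' where s': "s' = Leaf \<or> branching s'" "branchings k' s' = branchings j t'"
    "size s' \<le> size t'"
    "profile_map t' = (lengthen ^^ (size t' - size s')) (profile_map s')"
    using profile_map_trunk .
  have eq: "branchings k s = branchings k' s'" using less.prems s(2) s'(2) by simp
  have "size s = size s' \<and> profile_map s = profile_map s'"
  proof (cases "branching s")
    case False
    with s(1) have "s = Leaf" by blast
    then have "branchings k' s' = {}" using eq by simp
    then have "s' = Leaf" using s'(1) branching_root_cell[of s' k'] by blast
    then show ?thesis using \<open>s = Leaf\<close> by simp
  next
    case True
    then have "s' \<noteq> Leaf" using eq branching_root_cell[of s k] by fastforce
    then have "branching s'" using s'(1) by blast
    then have "k = k'" "size s = size s'"
      using branchings_subset_extent[OF True, of k k' s'] branchings_subset_extent[of s' k' k s] eq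
      by auto
    obtain l r l' r' where nodes: "s = Node l r" "s' = Node l' r'"
      using True \<open>branching s'\<close> by (metis branching.elims(2))
    note parts = branchings_Node_eqD[of k l r l' r', folded nodes,
        OF _ \<open>size s = size s'\<close> True \<open>branching s'\<close>]
    have "profile_map l = profile_map l'" "profile_map r = profile_map r'"
      using less.hyps[of l l' k k] less.hyps[of r r' "last_point k l" "last_point k l"]
        parts eq \<open>k = k'\<close> s(3) nodes by auto
    then show ?thesis using \<open>size s = size s'\<close> unfolding nodes by (intro conjI ext) simp_all
  qed
  then show ?case using s(4) s'(4) less.prems(1) by simp
qed

section \<open>Changing the root triangle\<close>

text \<open>A quadruple \<open>(i, a, b, c)\<close> is a triangulated polygon in which trees \<open>a\<close>, \<open>b\<close>, \<open>c\<close> are placed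
  one after the other on the sides of a root triangle, starting at the point \<open>i\<close>. Points are
  numbered modulo the number of vertices.\<close>

type_synonym rooted = "nat \<times> btree \<times> btree \<times> btree"

fun num_vertices :: "rooted \<Rightarrow> nat" where
  "num_vertices (i, a, b, c) = size a + size b + size c + 3"

fun disjoint_count :: "rooted \<Rightarrow> int" where
  "disjoint_count (i, a, b, c) = profile_map a (profile_map b (profile_map c num_triangs)) 1"

fun root_triangle :: "rooted \<Rightarrow> nat set" where
  "root_triangle (i, a, b, c) = {i, last_point i a, last_point (last_point i a) b}"

fun internal_cells :: "rooted \<Rightarrow> nat set set" where
  "internal_cells (i, a, b, c) = (`) (\<lambda>k. k mod num_vertices (i, a, b, c)) `
    (branchings i a \<union> branchings (last_point i a) b \<union> branchings (last_point (last_point i a) b) c \<union>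
     (if a = Leaf \<or> b = Leaf \<or> c = Leaf then {} else {root_triangle (i, a, b, c)}))"

definition rerooted :: "rooted \<Rightarrow> rooted \<Rightarrow> bool" where
  "rerooted p q \<longleftrightarrow> num_vertices p = num_vertices q \<and>
    disjoint_count p = disjoint_count q \<and> internal_cells p = internal_cells q"

lemma rerooted_refl: "rerooted p p"
  by (simp add: rerooted_def)

lemma rerooted_trans: "rerooted p q \<Longrightarrow> rerooted q r \<Longrightarrow> rerooted p r"
  by (simp add: rerooted_def)

lemma cells_shift: "cells (i + k) t = (`) (\<lambda>x. x + k) ` cells i t"
proof (induction t arbitrary: i)
  case (Node l r)
  show ?case using Node[of i] Node[of "last_point i l"] by (simp add: image_Un ac_simps)
qed simp

lemma branchings_shift: "branchings (i + k) t = (`) (\<lambda>x. x + k) ` branchings i t"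
proof -
  have "(\<forall>m\<in>(\<lambda>x. x + k) ` x. Suc m \<notin> (\<lambda>x. x + k) ` x) \<longleftrightarrow> (\<forall>m\<in>x. Suc m \<notin> x)" for x
    by auto
  then show ?thesis unfolding branchings_def cells_shift Compr_image_eq by simp
qed

lemma branchings_shift_mod:
  "(`) (\<lambda>k. k mod n) ` branchings (i + n) t = (`) (\<lambda>k. k mod n) ` branchings i t"
  unfolding branchings_shift by (simp add: image_image)

lemma rerooted_rotate: "rerooted (i, a, b, c) (last_point i a, b, c, a)"
proof -
  let ?n = "num_vertices (i, a, b, c)" and ?p = "last_point i a"
    and ?q = "last_point (last_point i a) b"
  let ?mod = "\<lambda>k. k mod ?n"
  have same: "num_vertices (?p, b, c, a) = ?n" and round: "last_point ?q c = i + ?n" by simp_all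
  have "?mod ` {?p, ?q, i + ?n} = ?mod ` {i, ?p, ?q}" by auto
  then have "internal_cells (?p, b, c, a) = internal_cells (i, a, b, c)"
    unfolding internal_cells.simps same round root_triangle.simps image_Un branchings_shift_mod
    by auto
  moreover have "disjoint_count (?p, b, c, a) = disjoint_count (i, a, b, c)"
    by (simp add: profile_map_commute[of _ a])
  ultimately show ?thesis using same by (simp only: rerooted_def)
qed

text \<open>Both counts equal
  \<open>profile_map a (profile_map b (profile_map c (profile_map d num_triangs))) 2 -
  profile_map a (profile_map b num_triangs) 1 * profile_map c (profile_map d num_triangs) 1\<close>,
  an expression in which the two triangles sharing the chord play the same role.\<close>

lemma rerooted_exchange: "rerooted (i, Node a b, c, d) (i, a, b, Node c d)"
proof -
  let ?n = "num_vertices (i, Node a b, c, d)" and ?m = "last_point i a"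
    and ?p = "last_point i (Node a b)"
    and ?q = "last_point (last_point i (Node a b)) c"
  let ?mod = "\<lambda>k. k mod ?n"
  have "disjoint_count (i, Node a b, c, d) = disjoint_count (i, a, b, Node c d)"
    by (simp add: profile_map_Node[of c d] profile_map_diff profile_map_Suc)
  moreover have "internal_cells (i, Node a b, c, d) = internal_cells (i, a, b, Node c d)"
  proof -
    have ends: "last_point ?m b = ?p" "last_point ?p (Node c d) = i + ?n" and
      same: "num_vertices (i, a, b, Node c d) = ?n" by simp_all
    have "?mod ` {?p, ?q, i + ?n} = ?mod ` {i, ?p, ?q}" by auto
    then show ?thesis
      unfolding internal_cells.simps same root_triangle.simps branchings_Node ends image_Un by auto
  qed
  ultimately show ?thesis by (simp only: rerooted_def) simp
qed

lemma reroot_at_branching: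
  assumes "x \<in> branchings i a"
  shows "\<exists>q. rerooted (i, a, b, c) q \<and> root_triangle q = x"
  using assms
proof (induction a arbitrary: i b c)
  case (Node a1 a2)
  let ?p = "(i, a1, a2, Node b c)"
  have "\<exists>q. rerooted ?p q \<and> root_triangle q = x"
  proof -
    consider "x = root_triangle ?p" | "x \<in> branchings i a1" | "x \<in> branchings (last_point i a1) a2"
      using Node.prems by (auto simp: branchings_Node add.assoc split: if_splits)
    then show ?thesis
    proof cases
      case 1
      then show ?thesis using rerooted_refl by blast
    next
      case 2
      then show ?thesis by (rule Node.IH)
    next
      case 3
      then obtain q where "rerooted (last_point i a1, a2, Node b c, a1) q" "root_triangle q = x"
        using Node.IH by blast
      then show ?thesis using rerooted_rotate rerooted_trans by blast
    qed
  qed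
  then show ?case using rerooted_exchange rerooted_trans by blast
qed simp

lemma reroot_at_ear_of_Node:
  assumes "a \<noteq> Leaf"
  shows "\<exists>i' d. rerooted (i, a, b, c) (i', Leaf, Leaf, d)"
  using assms
proof (induction a arbitrary: i b c)
  case (Node a1 a2)
  let ?p = "(i, a1, a2, Node b c)"
  have "\<exists>i' d. rerooted ?p (i', Leaf, Leaf, d)"
  proof -
    consider "a1 = Leaf" "a2 = Leaf" | "a1 \<noteq> Leaf" | "a2 \<noteq> Leaf" by blast
    then show ?thesis
    proof cases
      case 1
      then show ?thesis using rerooted_refl by blast
    next
      case 2
      then show ?thesis by (rule Node.IH)
    next
      case 3
      then have "\<exists>i' d. rerooted (last_point i a1, a2, Node b c, a1) (i', Leaf, Leaf, d)"
        by (rule Node.IH)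
      then show ?thesis using rerooted_rotate rerooted_trans by blast
    qed
  qed
  then show ?case using rerooted_exchange rerooted_trans by blast
qed simp

lemma reroot_at_ear:
  obtains i' d where "rerooted (i, a, b, c) (i', Leaf, Leaf, d)"
proof -
  have "\<exists>i' d. rerooted (i, a, b, c) (i', Leaf, Leaf, d)"
  proof -
    consider "a \<noteq> Leaf" | "b \<noteq> Leaf" | "a = Leaf" "b = Leaf" by blast
    then show ?thesis
      using reroot_at_ear_of_Node rerooted_rotate rerooted_trans rerooted_refl by cases blast+
  qed
  then show thesis using that by blast
qed

section \<open>The internal triangles determine the count\<close>

lemma inj_on_mod: "inj_on (\<lambda>k. k mod n) {i..<i + n :: nat}"
proof (rule linorder_inj_onI')
  fix k l assume kl: "k \<in> {i..<i + n}" "l \<in> {i..<i + n}" "k < l"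
  show "k mod n \<noteq> l mod n"
  proof
    assume "k mod n = l mod n"
    then have "n dvd l - k" using kl by (metis less_imp_le mod_eq_dvd_iff_nat)
    then show False using kl by (auto dest: dvd_imp_le)
  qed
qed

lemma branchings_eq_internal_cells:
  assumes "n = num_vertices (i, a, b, c)"
  shows "(`) (\<lambda>k. k mod n) ` branchings i a
    = {x \<in> internal_cells (i, a, b, c). x \<subseteq> (\<lambda>k. k mod n) ` {i..last_point i a}}"
proof -
  let ?p = "last_point i a" and ?f = "\<lambda>k. k mod n"
  define others where "others = branchings ?p b \<union> branchings (last_point ?p b) c \<union>
    (if a = Leaf \<or> b = Leaf \<or> c = Leaf then {} else {root_triangle (i, a, b, c)})"
  define within where "within x \<longleftrightarrow> x \<subseteq> ?f ` {i..?p}" for x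
  have "\<not> within (?f ` y)" if "y \<in> others" for y
  proof
    assume sub: "within (?f ` y)"
    obtain v where v: "v \<in> y" "?p < v" "v < i + n"
    proof -
      consider "y \<in> branchings ?p b" | "y \<in> branchings (last_point ?p b) c"
        | "y = root_triangle (i, a, b, c)"
        using \<open>y \<in> others\<close> unfolding others_def by (auto split: if_splits)
      then show thesis
      proof cases
        case 3
        then show thesis using that[of "last_point ?p b"] assms by simp
      qed (erule branchingsE, rule that, use assms in auto)+
    qed
    then have "?f v \<in> ?f ` {i..?p}" using sub unfolding within_def by blast
    then have "v \<in> {i..?p}"
      using v assms by (subst (asm) inj_on_image_mem_iff[OF inj_on_mod[of n i]]) auto
    then show False using v by simp
  qed
  moreover have "within (?f ` y)" if "y \<in> branchings i a" for y
    unfolding within_def using branchings_subset[OF that] by (rule image_mono)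
  moreover have "internal_cells (i, a, b, c) = (`) ?f ` branchings i a \<union> (`) ?f ` others"
    unfolding others_def assms by (simp only: internal_cells.simps image_Un Un_assoc)
  ultimately show ?thesis unfolding within_def[symmetric] by auto
qed

lemma profile_map_eq_of_internal_cells_eq:
  assumes "num_vertices (i, a, b, c) = num_vertices (i, a', b', c')" "size a = size a'"
    and "internal_cells (i, a, b, c) = internal_cells (i, a', b', c')"
  shows "profile_map a = profile_map a'"
proof -
  let ?f = "\<lambda>k. k mod num_vertices (i, a, b, c)"
  have "(`) ?f ` branchings i a = (`) ?f ` branchings i a'"
    using branchings_eq_internal_cells[OF refl, of i a b c]
      branchings_eq_internal_cells[OF assms(1)] assms(2,3)
    by simp
  moreover have "inj_on ?f {i..last_point i a}"
    by (rule inj_on_subset[OF inj_on_mod[of _ i]]) auto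
  then have "inj_on ((`) ?f) (Pow {i..last_point i a})" by (rule inj_on_image_Pow)
  moreover have "branchings i a \<subseteq> Pow {i..last_point i a}"
    "branchings i a' \<subseteq> Pow {i..last_point i a}"
    using branchings_subset[of _ i a] branchings_subset[of _ i a', folded assms(2)] by blast+
  ultimately have "branchings i a = branchings i a'" by (simp only: inj_on_image_eq_iff)
  then show ?thesis using assms(2) by (intro profile_map_eqI)
qed

lemma disjoint_count_eq_of_same_root:
  assumes "num_vertices (i, a, b, c) = num_vertices (i, a', b', c')"
    and "internal_cells (i, a, b, c) = internal_cells (i, a', b', c')"
    and "size a = size a'" "size b = size b'"
  shows "disjoint_count (i, a, b, c) = disjoint_count (i, a', b', c')"
proof -
  have sizes: "size c = size c'" using assms(1,3,4) by simp
  have rotated: "num_vertices (last_point i a, b, c, a) = num_vertices (last_point i a, b', c', a')"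
    "internal_cells (last_point i a, b, c, a) = internal_cells (last_point i a, b', c', a')"
    using rerooted_rotate[of i a b c] rerooted_rotate[of i a' b' c'] assms
    by (simp_all only: rerooted_def)
  let ?q = "last_point (last_point i a) b"
  have "num_vertices (?q, c, a, b) = num_vertices (?q, c', a', b')"
    "internal_cells (?q, c, a, b) = internal_cells (?q, c', a', b')"
    using rerooted_rotate[of "last_point i a" b c a] rerooted_rotate[of "last_point i a" b' c' a']
      rotated assms(4)
    by (simp_all only: rerooted_def)
  then have "profile_map c = profile_map c'"
    using sizes by (intro profile_map_eq_of_internal_cells_eq)
  moreover have "profile_map b = profile_map b'"
    using rotated assms by (intro profile_map_eq_of_internal_cells_eq)
  moreover have "profile_map a = profile_map a'"
    using assms by (intro profile_map_eq_of_internal_cells_eq)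
  ultimately show ?thesis by simp
qed

lemma root_triangle_eqD:
  assumes "root_triangle (i, a, b, c) = root_triangle (i', a', b', c')"
  shows "i = i'" "size a = size a'" "size b = size b'"
proof -
  let ?p = "last_point i a" and ?p' = "last_point i' a'"
  let ?q = "last_point ?p b" and ?q' = "last_point ?p' b'"
  have eq: "{i, ?p, ?q} = {i', ?p', ?q'}" using assms by simp
  then have "i \<in> {i', ?p', ?q'}" "i' \<in> {i, ?p, ?q}" by blast+
  then show i: "i = i'" by auto
  have "?q \<in> {i', ?p', ?q'}" "?q' \<in> {i, ?p, ?q}" using eq by blast+
  then have q: "?q = ?q'" by auto
  have "?p \<in> {i', ?p', ?q'}" using eq by blast
  then show a: "size a = size a'" using i q by auto
  show "size b = size b'" using i q a by simp
qed

text \<open>In \<open>(0, l, r, Leaf)\<close> no point number reaches the number of vertices, so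
  nothing is reduced.\<close>

lemma internal_cells_rooted_at_side:
  "internal_cells (0, l, r, Leaf) = branchings 0 l \<union> branchings (last_point 0 l) r"
proof -
  have "(\<lambda>k. k mod num_vertices (0, l, r, Leaf)) ` x = x"
    if "x \<in> branchings 0 l \<union> branchings (last_point 0 l) r" for x
    using that by (auto elim!: branchingsE)
  then show ?thesis by simp
qed

lemma reroot_at_internal_cell:
  assumes "x \<in> internal_cells (0, l, r, Leaf)"
  obtains i a b c where "rerooted (0, l, r, Leaf) (i, a, b, c)" "root_triangle (i, a, b, c) = x"
proof -
  have "\<exists>q. rerooted (0, l, r, Leaf) q \<and> root_triangle q = x"
    using assms unfolding internal_cells_rooted_at_side
  proof
    assume "x \<in> branchings (last_point 0 l) r"
    then have "\<exists>q. rerooted (last_point 0 l, r, Leaf, l) q \<and> root_triangle q = x"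
      by (rule reroot_at_branching)
    then show ?thesis using rerooted_rotate rerooted_trans by blast
  qed (rule reroot_at_branching)
  then show thesis using that by (metis prod_cases4)
qed

lemma disjoint_count_eqI:
  assumes size: "num_vertices (0, l, r, Leaf) = num_vertices (0, l', r', Leaf)"
    and eq: "internal_cells (0, l, r, Leaf) = internal_cells (0, l', r', Leaf)"
  shows "disjoint_count (0, l, r, Leaf) = disjoint_count (0, l', r', Leaf)"
proof (cases "internal_cells (0, l, r, Leaf) = {}")
  case True
  obtain i d where d: "rerooted (0, l, r, Leaf) (i, Leaf, Leaf, d)" by (rule reroot_at_ear)
  obtain i' d' where d': "rerooted (0, l', r', Leaf) (i', Leaf, Leaf, d')" by (rule reroot_at_ear)
  have "internal_cells (i, Leaf, Leaf, d) = {}" "internal_cells (i', Leaf, Leaf, d') = {}"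
    using d d' True eq by (simp_all only: rerooted_def)
  moreover have "size d = size d'" using d d' size by (simp add: rerooted_def)
  ultimately have "profile_map d = profile_map d'"
    by (intro profile_map_eqI[of d d' "i + 2" "i' + 2"]) auto
  then have "disjoint_count (i, Leaf, Leaf, d) = disjoint_count (i', Leaf, Leaf, d')" by simp
  then show ?thesis using d d' by (simp only: rerooted_def)
next
  case False
  then obtain x where "x \<in> internal_cells (0, l, r, Leaf)" "x \<in> internal_cells (0, l', r', Leaf)"
    using eq by blast
  then obtain i a b c i' a' b' c' where
    p: "rerooted (0, l, r, Leaf) (i, a, b, c)" "root_triangle (i, a, b, c) = x" and
    p': "rerooted (0, l', r', Leaf) (i', a', b', c')" "root_triangle (i', a', b', c') = x"
    by (meson reroot_at_internal_cell)
  have same: "i = i'" "size a = size a'" "size b = size b'"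
    using root_triangle_eqD[of i a b c i' a' b' c'] p(2) p'(2) by (simp_all only:)
  have "disjoint_count (i, a, b, c) = disjoint_count (i', a', b', c')"
    using p(1) p'(1) size eq same(2,3) unfolding same(1)
    by (intro disjoint_count_eq_of_same_root) (simp_all only: rerooted_def)
  then show ?thesis using p(1) p'(1) by (simp only: rerooted_def)
qed

section \<open>Triangulations as trees\<close>

lemma non_chord_mem_maximal_indep:
  assumes E: "maximal_indep crosses (segments V) E" and e: "e \<in> segments V" "e \<notin> chords V"
  shows "e \<in> E"
  using e(1)
proof (rule maximal_indep_memI[OF E])
  show "\<not> crosses e d" if "d \<in> E" for d
    using e that maximal_indep_subset[OF E] unfolding chords_def by blast
qed

lemma maximal_indep_segments_restrict:
  assumes E: "maximal_indep crosses (segments V) E" and ab: "{a, b} \<in> E" "a < b"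
  shows "maximal_indep crosses (segments (V \<inter> {a..b})) (E \<inter> segments (V \<inter> {a..b}))"
proof -
  have "d \<in> E" if d: "d \<in> segments (V \<inter> {a..b})" and
    free: "\<And>e. e \<in> E \<inter> segments (V \<inter> {a..b}) \<Longrightarrow> \<not> crosses d e" for d
  proof (rule maximal_indep_memI[OF E])
    show "d \<in> segments V" using d segments_mono[of "V \<inter> {a..b}" V] by blast
    fix e assume e: "e \<in> E"
    then have "e \<in> segments V" using maximal_indep_subset[OF E] by blast
    then obtain p q where pq: "e = {p, q}" "p < q" "p \<in> V" "q \<in> V" by (rule segmentsE)
    obtain r s where rs: "d = {r, s}" "r < s" "r \<in> {a..b}" "s \<in> {a..b}"
      using d by (auto elim: segmentsE)
    have "\<not> crosses {a, b} e" using maximal_indepD[OF E ab(1) e] .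
    then have "\<not> (a < p \<and> p < b \<and> b < q)" "\<not> (p < a \<and> a < q \<and> q < b)"
      using pq ab(2) by (auto simp: crosses_iff)
    moreover have "(r < p \<and> p < s \<and> s < q) \<or> (p < r \<and> r < q \<and> q < s)" if "crosses d e"
      using that pq rs by (simp add: crosses_iff)
    ultimately have "p \<in> {a..b}" "q \<in> {a..b}" if "crosses d e" using that rs by auto
    then have "e \<in> segments (V \<inter> {a..b})" if "crosses d e" using that pq by (simp add: segments_iff)
    then show "\<not> crosses d e" using free e by blast
  qed
  then show ?thesis
    using maximal_indepD[OF E] unfolding maximal_indep_def[of _ "segments (V \<inter> {a..b})"] by blast
qed

text \<open>The apex of the triangle resting on the segment from \<open>i\<close> to \<open>j\<close> is the last neighbour of \<open>i\<close>
  before \<open>j\<close>.\<close>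

lemma maximal_indep_segments_apex:
  assumes E: "maximal_indep crosses (segments {i..j}) E" and ij: "i + 1 < j"
  obtains m where "i < m" "m < j" "{i, m} \<in> E" "{m, j} \<in> E"
proof -
  define M where "M = {m. i < m \<and> m < j \<and> {i, m} \<in> E}"
  define m where "m = Max M"
  have segment: "e \<in> segments {i..j}" if "e \<in> E" for e
    using maximal_indep_subset[OF E] that by blast
  have "finite M" by (rule finite_subset[of _ "{..<j}"]) (auto simp: M_def)
  moreover have "{i, Suc i} \<in> E"
    by (rule non_chord_mem_maximal_indep[OF E]) (use ij in \<open>auto simp: segments_iff chords_iff\<close>)
  then have "Suc i \<in> M" using ij by (simp add: M_def)
  ultimately have "m \<in> M" and max: "\<And>q. q \<in> M \<Longrightarrow> q \<le> m" unfolding m_def using Max_in Max_ge by blast+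
  then have m: "i < m" "m < j" "{i, m} \<in> E" by (auto simp: M_def)
  moreover have "{m, j} \<in> E"
  proof (rule maximal_indep_memI[OF E])
    show "{m, j} \<in> segments {i..j}" using m by (simp add: segments_iff)
    fix e assume e: "e \<in> E"
    then obtain p q where pq: "e = {p, q}" "p < q" "i \<le> p" "q \<le> j"
      using segment by (force elim: segmentsE)
    have "\<not> (i < p \<and> p < m \<and> m < q)"
      using maximal_indepD[OF E m(3) e] pq m by (auto simp: crosses_iff)
    moreover have "\<not> (p = i \<and> m < q \<and> q < j)" using max[of q] e pq(1) m(1) by (force simp: M_def)
    ultimately show "\<not> crosses {m, j} e" using pq m by (auto simp: crosses_iff)
  qed
  ultimately show thesis using that by blast
qed

lemma maximal_indep_segments_split:
  assumes E: "maximal_indep crosses (segments {i..j}) E"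
    and m: "i < m" "m < j" "{i, m} \<in> E" "{m, j} \<in> E"
  shows "E = insert {i, j} (E \<inter> segments {i..m} \<union> E \<inter> segments {m..j})"
proof -
  have "e = {i, j} \<or> e \<in> segments {i..m} \<or> e \<in> segments {m..j}" if e: "e \<in> E" for e
  proof -
    have "e \<in> segments {i..j}" using e maximal_indep_subset[OF E] by blast
    then obtain p q where pq: "e = {p, q}" "p < q" "i \<le> p" "q \<le> j" by (force elim: segmentsE)
    have "\<not> crosses {i, m} e" "\<not> crosses {m, j} e" using maximal_indepD[OF E] m e by blast+
    then have "p = i \<and> q = j \<or> q \<le> m \<or> m \<le> p" using pq m by (auto simp: crosses_iff)
    then show ?thesis using pq by (auto simp: segments_iff)
  qed
  moreover have "{i, j} \<in> E"
    by (rule non_chord_mem_maximal_indep[OF E]) (use m in \<open>auto simp: segments_iff chords_iff\<close>)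
  ultimately show ?thesis by blast
qed

lemma maximal_indep_segments_eq_edges:
  assumes "maximal_indep crosses (segments {i..j}) E" "i < j"
  shows "\<exists>t. j = last_point i t \<and> E = edges i t"
  using assms
proof (induction "j - i" arbitrary: i j E rule: less_induct)
  case less
  note E = less.prems(1)
  show ?case
  proof (cases "j = Suc i")
    case True
    have "segments {i..Suc i} \<subseteq> {{i, Suc i}}" by (auto elim!: segmentsE simp: le_Suc_eq)
    moreover have "{i, Suc i} \<in> E"
      by (rule non_chord_mem_maximal_indep[OF E]) (use True in \<open>auto simp: segments_iff chords_iff\<close>)
    ultimately have "E = {{i, Suc i}}" using maximal_indep_subset[OF E] True by blast
    then show ?thesis using True by (intro exI[of _ Leaf]) simp
  next
    case False
    then obtain m where m: "i < m" "m < j" "{i, m} \<in> E" "{m, j} \<in> E"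
      using maximal_indep_segments_apex[OF E] less.prems(2) by (metis Suc_eq_plus1 Suc_lessI)
    have inter: "{i..j} \<inter> {i..m} = {i..m}" "{i..j} \<inter> {m..j} = {m..j}" using m by auto
    obtain l where l: "m = last_point i l" "E \<inter> segments {i..m} = edges i l"
      using less.hyps[OF _ maximal_indep_segments_restrict[OF E m(3,1), unfolded inter] m(1)] m
      by force
    obtain r where r: "j = last_point m r" "E \<inter> segments {m..j} = edges m r"
      using less.hyps[OF _ maximal_indep_segments_restrict[OF E m(4,2), unfolded inter] m(2)] m
      by force
    have "E = insert {i, j} (edges i l \<union> edges m r)"
      using maximal_indep_segments_split[OF E m] unfolding l(2) r(2) .
    then have "j = last_point i (Node l r) \<and> E = edges i (Node l r)"
      using l(1) r(1) by (simp add: add.assoc)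
    then show ?thesis ..
  qed
qed

section \<open>Cells as triples of edges\<close>

definition closed_triples :: "nat set set \<Rightarrow> nat set set" where
  "closed_triples E = {{a, b, c} | a b c. a < b \<and> b < c \<and> {a, b} \<in> E \<and> {b, c} \<in> E \<and> {a, c} \<in> E}"

lemma closed_triples_mono: "E \<subseteq> F \<Longrightarrow> closed_triples E \<subseteq> closed_triples F"
  unfolding closed_triples_def by blast

lemma edges_bounds: "{a, b} \<in> edges i t \<Longrightarrow> i \<le> a \<and> b \<le> last_point i t"
  using edges_subset_segments[of i t] segments_subset_Pow[of "{i..last_point i t}"] by fastforce

lemma edges_base: "{i, last_point i t} \<in> edges i t"
  by (cases t) auto

lemma closed_triples_Un:
  assumes "E \<subseteq> segments {..m}" "F \<subseteq> segments {m..}"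
  shows "closed_triples (E \<union> F) = closed_triples E \<union> closed_triples F"
proof (intro equalityI Un_least closed_triples_mono subsetI)
  fix x assume "x \<in> closed_triples (E \<union> F)"
  then obtain a b c where x: "x = {a, b, c}" "a < b" "b < c"
    and ab: "{a, b} \<in> E \<union> F" and bc: "{b, c} \<in> E \<union> F" and ac: "{a, c} \<in> E \<union> F"
    unfolding closed_triples_def by blast
  have left: "q \<le> m" if "{p, q} \<in> E" "p < q" for p q
    using subsetD[OF assms(1) that(1)] that(2) by (simp add: segments_iff)
  have right: "m \<le> p" if "{p, q} \<in> F" "p < q" for p q
    using subsetD[OF assms(2) that(1)] that(2) by (simp add: segments_iff)
  show "x \<in> closed_triples E \<union> closed_triples F"
  proof (cases "{a, c} \<in> E")
    case True
    then have "{a, b} \<notin> F" "{b, c} \<notin> F" using left[of a c] right[of a b] right[of b c] x by auto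
    then show ?thesis using True ab bc x unfolding closed_triples_def by blast
  next
    case False
    then have "{a, c} \<in> F" using ac by blast
    moreover have "{a, b} \<notin> E" "{b, c} \<notin> E"
      using right[OF calculation] left[of a b] left[of b c] x by auto
    ultimately show ?thesis using ab bc x unfolding closed_triples_def by blast
  qed
qed blast+

lemma closed_triples_insert_base:
  assumes m: "m = last_point i l" and j: "j = last_point m r"
    and x: "x \<in> closed_triples (insert {i, j} (edges i l \<union> edges m r))"
  shows "x = {i, m, j} \<or> x \<in> closed_triples (edges i l \<union> edges m r)"
proof -
  let ?E = "edges i l \<union> edges m r"
  have ij: "i < m" "m < j" using m j by auto
  have left: "i \<le> p \<and> q \<le> m" if "{p, q} \<in> edges i l" for p q using edges_bounds[OF that] m by simp
  have right: "m \<le> p \<and> q \<le> j" if "{p, q} \<in> edges m r" for p q using edges_bounds[OF that] j by simp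
  obtain a b c where abc: "x = {a, b, c}" "a < b" "b < c" and E: "{a, b} \<in> insert {i, j} ?E"
    "{b, c} \<in> insert {i, j} ?E" "{a, c} \<in> insert {i, j} ?E"
    using x unfolding closed_triples_def by blast
  then have "i \<le> a" "c \<le> j" using left[of a c] right[of a c] ij by (auto simp: doubleton_eq_iff)
  then have sides: "{a, b} \<in> ?E" "{b, c} \<in> ?E" using E(1,2) abc ij by (auto simp: doubleton_eq_iff)
  show ?thesis
  proof (cases "{a, c} = {i, j}")
    case True
    then have ac: "a = i" "c = j" using abc ij by (auto simp: doubleton_eq_iff)
    then have "b \<le> m" "m \<le> b"
      using sides left[of a b] right[of a b] left[of b c] right[of b c] ij by auto
    then show ?thesis using abc ac by simp
  next
    case False
    then have "{a, c} \<in> ?E" using E(3) by blast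
    then show ?thesis using abc sides unfolding closed_triples_def by blast
  qed
qed

lemma closed_triples_edges_Node:
  assumes m: "m = last_point i l" and j: "j = last_point m r"
  shows "closed_triples (insert {i, j} (edges i l \<union> edges m r)) =
    insert {i, m, j} (closed_triples (edges i l) \<union> closed_triples (edges m r))"
proof -
  let ?E = "edges i l \<union> edges m r"
  have "segments {i..m} \<subseteq> segments {..m}" "segments {m..j} \<subseteq> segments {m..}"
    by (rule segments_mono, force)+
  then have "edges i l \<subseteq> segments {..m}" "edges m r \<subseteq> segments {m..}"
    using edges_subset_segments[of i l] edges_subset_segments[of m r] m j by blast+
  then have "closed_triples ?E = closed_triples (edges i l) \<union> closed_triples (edges m r)"
    by (rule closed_triples_Un)
  moreover have "closed_triples (insert {i, j} ?E) \<subseteq> insert {i, m, j} (closed_triples ?E)"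
    using closed_triples_insert_base[OF m j] by blast
  moreover have "{i, m, j} \<in> closed_triples (insert {i, j} ?E)"
  proof -
    have "{i, m} \<in> ?E" "{m, j} \<in> ?E" using edges_base[of i l] edges_base[of m r] m j by auto
    moreover have "i < m" "m < j" using m j by auto
    ultimately show ?thesis unfolding closed_triples_def by blast
  qed
  moreover have "closed_triples ?E \<subseteq> closed_triples (insert {i, j} ?E)"
    by (rule closed_triples_mono) blast
  ultimately show ?thesis by blast
qed

lemma closed_triples_edges: "closed_triples (edges i t) = cells i t"
proof (induction t arbitrary: i)
  case Leaf
  show ?case by (auto simp: closed_triples_def doubleton_eq_iff)
next
  case (Node l r)
  show ?case
    using closed_triples_edges_Node[OF refl refl, of i l r] by (simp add: Node.IH add.assoc)
qed

section \<open>The polygon\<close>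

lemma is_side_iff:
  assumes "a < b" "b < n"
  shows "is_side n a b \<longleftrightarrow> b = a + 1 \<or> (a = 0 \<and> b + 1 = n)"
proof -
  have "(a + 1) mod n = a + 1" using assms by simp
  moreover have "(b + 1) mod n = (if b + 1 = n then 0 else b + 1)" using assms by simp
  ultimately show ?thesis using assms unfolding is_side_def by auto
qed

lemma is_side_sym: "is_side n a b \<longleftrightarrow> is_side n b a"
  unfolding is_side_def by blast

lemma diagonalsE:
  assumes "e \<in> diagonals n"
  obtains a b where "e = {a, b}" "a < b"
proof -
  obtain p q where pq: "e = {p, q}" "p \<noteq> q" using assms unfolding diagonals_def by blast
  then consider "p < q" | "q < p" by linarith
  then show thesis using that[of p q] that[of q p] pq(1) by cases (auto simp: insert_commute)
qed

lemma diagonals_iff: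
  assumes "a < b"
  shows "{a, b} \<in> diagonals n \<longleftrightarrow> b < n \<and> \<not> is_side n a b"
proof
  assume "{a, b} \<in> diagonals n"
  then obtain p q where "{a, b} = {p, q}" "p < n" "q < n" "\<not> is_side n p q"
    unfolding diagonals_def by blast
  then show "b < n \<and> \<not> is_side n a b" using is_side_sym[of n a b] by (auto simp: doubleton_eq_iff)
next
  assume "b < n \<and> \<not> is_side n a b"
  then show "{a, b} \<in> diagonals n" using assms unfolding diagonals_def
    by (intro CollectI exI[of _ a] exI[of _ b]) auto
qed

lemma diagonals_eq_chords: "diagonals n = chords {0..n - 1}"
proof -
  have iff: "{a, b} \<in> diagonals n \<longleftrightarrow> {a, b} \<in> chords {0..n - 1}" if ab: "a < b" for a b
  proof (cases "b < n")
    case True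
    have "(\<exists>x\<in>{0..n - 1}. a < x \<and> x < b) \<longleftrightarrow> b \<noteq> a + 1"
      using ab True by (auto intro: bexI[of _ "a + 1"])
    moreover have "(\<exists>x\<in>{0..n - 1}. x < a \<or> b < x) \<longleftrightarrow> \<not> (a = 0 \<and> b + 1 = n)"
      using ab True by (auto intro: bexI[of _ 0] bexI[of _ "n - 1"])
    ultimately show ?thesis
      using ab True by (auto simp: diagonals_iff[OF ab] chords_iff[OF ab] is_side_iff[OF ab True])
  next
    case False
    then show ?thesis using ab by (auto simp: diagonals_iff[OF ab] chords_iff[OF ab])
  qed
  show ?thesis
  proof (intro equalityI subsetI)
    fix e assume e: "e \<in> diagonals n"
    then obtain a b where "e = {a, b}" "a < b" by (rule diagonalsE)
    then show "e \<in> chords {0..n - 1}" using e iff by blast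
  next
    fix e assume e: "e \<in> chords {0..n - 1}"
    then obtain a b where "e = {a, b}" "a < b" by (rule chordsE)
    then show "e \<in> diagonals n" using e iff by blast
  qed
qed

lemma triangulation_iff: "triangulation n T \<longleftrightarrow> maximal_indep crosses (diagonals n) T"
proof
  assume T: "triangulation n T"
  then have "T \<subseteq> diagonals n" and nc: "\<forall>d\<in>T. \<forall>e\<in>T. \<not> crosses d e"
    and max: "\<And>d. d \<in> diagonals n \<Longrightarrow> d \<notin> T \<Longrightarrow> \<not> noncrossing (insert d T)"
    unfolding triangulation_def noncrossing_def by auto
  have "d \<in> T" if d: "d \<in> diagonals n" "\<forall>e\<in>T. \<not> crosses d e" for d
  proof (rule ccontr)
    assume "d \<notin> T"
    moreover have "\<not> crosses d d"
      using d(1) not_crosses_self chords_subset_segments unfolding diagonals_eq_chords by blast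
    then have "noncrossing (insert d T)"
      using nc d(2) symp_crosses unfolding noncrossing_def by (auto dest: sympD)
    ultimately show False using max d(1) by blast
  qed
  then show "maximal_indep crosses (diagonals n) T"
    using \<open>T \<subseteq> diagonals n\<close> nc unfolding maximal_indep_def by blast
next
  assume T: "maximal_indep crosses (diagonals n) T"
  then show "triangulation n T"
    unfolding triangulation_def noncrossing_def
    using maximal_indep_subset[OF T] maximal_indepD[OF T] maximal_indep_memI[OF T] by blast
qed

lemma maximal_indep_chords_Un:
  assumes "maximal_indep crosses (chords V) T"
  shows "maximal_indep crosses (segments V) (T \<union> (segments V - chords V))"
proof -
  let ?free = "segments V - chords V"
  have free: "\<not> crosses d e \<and> \<not> crosses e d" if "d \<in> segments V" "e \<in> ?free" for d e
    using that symp_crosses unfolding chords_def by (blast dest: sympD)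
  then have "maximal_indep crosses ?free ?free" unfolding maximal_indep_def by blast
  then have "maximal_indep crosses (chords V \<union> ?free) (T \<union> ?free)"
    using assms free chords_subset_segments maximal_indep_subset[OF assms]
    by (subst maximal_indep_Un_iff) blast+
  moreover have "chords V \<union> ?free = segments V" using chords_subset_segments by blast
  ultimately show ?thesis by simp
qed

definition with_sides :: "nat \<Rightarrow> nat set set \<Rightarrow> nat set set" where
  "with_sides n T = T \<union> (segments {0..n - 1} - diagonals n)"

lemma triangulation_edges:
  assumes "n \<ge> 3" "triangulation n T"
  obtains l r where "n = num_vertices (0, l, r, Leaf)"
    "edges 0 (Node l r) = with_sides n T"
proof -
  have "maximal_indep crosses (segments {0..n - 1}) (with_sides n T)"
    using maximal_indep_chords_Un assms(2)
    unfolding with_sides_def triangulation_iff diagonals_eq_chords .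
  then obtain t where t: "n - 1 = last_point 0 t" "edges 0 t = with_sides n T"
    using maximal_indep_segments_eq_edges[of 0 "n - 1"] assms(1) by fastforce
  then obtain l r where "t = Node l r" using assms(1) by (cases t) auto
  moreover from this have "n = num_vertices (0, l, r, Leaf)" using t(1) assms(1) by simp
  ultimately show thesis using that t(2) by blast
qed

lemma triangles_eq_closed_triples:
  assumes "T \<subseteq> diagonals n"
  shows "triangles n T = closed_triples (with_sides n T)"
proof -
  let ?E = "with_sides n T"
  have iff: "b < n \<and> (is_side n a b \<or> {a, b} \<in> T) \<longleftrightarrow> {a, b} \<in> ?E" if "a < b" for a b
    using assms diagonals_iff[OF that, of n] that by (auto simp: with_sides_def segments_iff)
  have "a < b \<and> b < c \<and> c < n \<and> (is_side n a b \<or> {a, b} \<in> T) \<and> (is_side n b c \<or> {b, c} \<in> T) \<and>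
      (is_side n a c \<or> {a, c} \<in> T)
    \<longleftrightarrow> a < b \<and> b < c \<and> {a, b} \<in> ?E \<and> {b, c} \<in> ?E \<and> {a, c} \<in> ?E" for a b c
    using iff[of a b] iff[of b c] iff[of a c] by (meson less_trans)
  then show ?thesis unfolding triangles_def closed_triples_def by simp
qed

lemma cell_without_sides_iff:
  assumes "x \<in> cells 0 t" "n = size t + 2"
  shows "(\<forall>i\<in>x. \<forall>j\<in>x. i \<noteq> j \<longrightarrow> \<not> is_side n i j) \<longleftrightarrow> (\<forall>k\<in>x. Suc k \<notin> x) \<and> \<not> {0, n - 1} \<subseteq> x"
proof -
  obtain a b c where x: "x = {a, b, c}" "a < b" "b < c" "c < n"
    using assms by (elim cellsE) auto
  have "(\<forall>i\<in>x. \<forall>j\<in>x. i \<noteq> j \<longrightarrow> \<not> is_side n i j) \<longleftrightarrow>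
      \<not> is_side n a b \<and> \<not> is_side n b c \<and> \<not> is_side n a c"
    unfolding x(1) using is_side_sym[of n] x(2,3) by auto
  also have "\<dots> \<longleftrightarrow> b \<noteq> Suc a \<and> c \<noteq> Suc b \<and> \<not> (a = 0 \<and> c = n - 1)"
    using x by (auto simp: is_side_iff)
  also have "\<dots> \<longleftrightarrow> (\<forall>k\<in>x. Suc k \<notin> x) \<and> \<not> {0, n - 1} \<subseteq> x"
    unfolding x(1) using x(2-4) by auto
  finally show ?thesis .
qed

lemma internal_triangles_eq_internal_cells:
  assumes "T \<subseteq> diagonals n" and n: "n = num_vertices (0, l, r, Leaf)"
    and E: "edges 0 (Node l r) = with_sides n T"
  shows "internal_triangles n T = internal_cells (0, l, r, Leaf)"
proof -
  let ?t = "Node l r" and ?m = "last_point 0 l"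
  have "n = size ?t + 2" using n by simp
  note without_sides_iff = cell_without_sides_iff[OF _ this]
  have "internal_triangles n T = {x \<in> branchings 0 ?t. \<not> {0, n - 1} \<subseteq> x}"
    unfolding internal_triangles_def triangles_eq_closed_triples[OF assms(1)] E[symmetric]
      closed_triples_edges branchings_def
    by (simp only: mem_Collect_eq without_sides_iff conj_assoc cong: conj_cong)
  also have "\<dots> = branchings 0 l \<union> branchings ?m r"
  proof -
    have "n - 1 \<notin> x" if "x \<in> branchings 0 l" for x using that n by (auto elim!: branchingsE)
    moreover have "0 \<notin> x" if "x \<in> branchings ?m r" for x using that by (auto elim!: branchingsE)
    moreover have "{0, n - 1} \<subseteq> {0, ?m, last_point 0 ?t}" using n by simp
    ultimately show ?thesis unfolding branchings_Node by auto
  qed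
  finally show ?thesis unfolding internal_cells_rooted_at_side .
qed

lemma card_disjoint_triangs:
  assumes "T \<subseteq> diagonals n" and n: "n = num_vertices (0, l, r, Leaf)"
    and E: "edges 0 (Node l r) = with_sides n T"
  shows "int (card {T'. triangulation n T' \<and> disjoint_triangs T' T})
    = disjoint_count (0, l, r, Leaf)"
proof -
  let ?m = "last_point 0 l"
  have j: "n - 1 = last_point ?m r" using n by simp
  have "{0, n - 1} \<notin> diagonals n"
    using diagonals_iff[of 0 "n - 1" n] is_side_iff[of 0 "n - 1" n] n by simp
  then have "(edges 0 l \<union> edges ?m r) \<inter> diagonals n
      = insert {0, n - 1} (edges 0 l \<union> edges ?m r) \<inter> diagonals n" by simp
  also have "\<dots> = with_sides n T \<inter> diagonals n" using E n by simp
  also have "\<dots> = T \<inter> diagonals n" unfolding with_sides_def by blast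
  finally have "T \<inter> diagonals n = (edges 0 l \<union> edges ?m r) \<inter> diagonals n" by (rule sym)
  then have "num_triangs_avoiding {0..n - 1} T
      = num_triangs_avoiding {0..n - 1} (edges 0 l \<union> edges ?m r)"
    unfolding diagonals_eq_chords by (rule num_avoiding_cong)
  also have "\<dots> = disjoint_count (0, l, r, Leaf)"
    using num_triangs_avoiding_pair[OF acts_on_profiles acts_on_profiles refl j]
    by (simp add: profile_map_Leaf)
  finally show ?thesis
    by (simp add: num_avoiding_def triangulation_iff disjoint_triangs_def diagonals_eq_chords)
qed

lemma triangulation_rooted_tree:
  assumes "n \<ge> 3" "triangulation n T"
  obtains l r where "num_vertices (0, l, r, Leaf) = n"
    "internal_cells (0, l, r, Leaf) = internal_triangles n T"
    "disjoint_count (0, l, r, Leaf) = int (card {T'. triangulation n T' \<and> disjoint_triangs T' T})"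
proof -
  obtain l r where n: "n = num_vertices (0, l, r, Leaf)" and
    E: "edges 0 (Node l r) = with_sides n T"
    using triangulation_edges[OF assms] .
  have "T \<subseteq> diagonals n" using assms(2) unfolding triangulation_def by blast
  then show thesis
    using that n internal_triangles_eq_internal_cells[OF _ n E] card_disjoint_triangs[OF _ n E]
    by simp
qed

theorem theorem3p3:
  fixes n :: nat and T1 T2 :: "nat set set"
  assumes "n \<ge> 4"
    and "triangulation n T1" and "triangulation n T2"
    and "internal_triangles n T1 = internal_triangles n T2"
  shows "card {T. triangulation n T \<and> disjoint_triangs T T1}
       = card {T. triangulation n T \<and> disjoint_triangs T T2}"
proof -
  have n: "n \<ge> 3" using assms(1) by simp
  obtain l r where tree1: "num_vertices (0, l, r, Leaf) = n"
    "internal_cells (0, l, r, Leaf) = internal_triangles n T1"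
    "disjoint_count (0, l, r, Leaf) = int (card {T. triangulation n T \<and> disjoint_triangs T T1})"
    using triangulation_rooted_tree[OF n assms(2)] .
  obtain l' r' where tree2: "num_vertices (0, l', r', Leaf) = n"
    "internal_cells (0, l', r', Leaf) = internal_triangles n T2"
    "disjoint_count (0, l', r', Leaf) = int (card {T. triangulation n T \<and> disjoint_triangs T T2})"
    using triangulation_rooted_tree[OF n assms(3)] .
  have "disjoint_count (0, l, r, Leaf) = disjoint_count (0, l', r', Leaf)"
    using tree1(1,2) tree2(1,2) assms(4) by (intro disjoint_count_eqI) simp_all
  then show ?thesis using tree1(3) tree2(3) by simp
qed

end
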